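(* Let $k\in\{0,1,2,\dots\}$, let $\rho\in\mathbb{C}$, and let $a,b,c,d>0$ except for possibly a pair of complex conjugates with positive real parts among $a,b,c$ and among $a,b,d$. Then $$ \int_0^\infty e^\rho\ {}_2F_2\!\left(\begin{matrix}a+ix,\ a-ix\\ a+b,\ a+c\end{matrix};-\rho\right)\left|\frac{\Gamma(a+ix)\Gamma(b+ix)\Gamma(d+ix)}{\Gamma(2ix)}\right|^2S_k(x^2;a,b,d)\,dx $$ $$ =2\pi\,\frac{\Gamma(a+b)\Gamma(k+a+d)\Gamma(k+b+d)}{(a+c)_k}\ {}_1F_1\!\left(\begin{matrix}c-d\\ k+a+c\end{matrix};\rho\right)\rho^k. $$
   Context: The Pochhammer symbol is $(z)_n=\prod_{i=1}^n(z+i-1)$ (so $(z)_0=1$). The generalized hypergeometric function is ${}_pF_q(a_1,\dots,a_p;b_1,\dots,b_q;z)=\sum_{n\ge0}\frac{(a_1)_n\cdots(a_p)_n}{(b_1)_n\cdots(b_q)_n}\frac{z^n}{n!}$. The continuous dual Hahn polynomials are $$S_n(x^2;a,b,c)=(a+b)_n(a+c)_n\ {}_3F_2\!\left(\begin{matrix}-n,\ a+ix,\ a-ix\\ a+b,\ a+c\end{matrix};1\right).$$ The parameter hypothesis means: all parameters have positive real part, and in each of the lists $a,b,c$ and $a,b,d$ the non-real entries (if any) form a complex conjugate pair. *)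

theory Defs
  imports "HOL-Analysis.Analysis"
begin

definition pFq :: "complex list \<Rightarrow> complex list \<Rightarrow> complex \<Rightarrow> complex" where
  "pFq as bs z = eval_fps (fps_hypergeo as bs 1) z"

lemma pFq_altdef:
  "pFq as bs z =
     (\<Sum>n. (\<Prod>a\<leftarrow>as. pochhammer a n) / (\<Prod>b\<leftarrow>bs. pochhammer b n) * (z ^ n / fact n))"
proof -
  have "foldl (\<lambda>r a. r * pochhammer a n) r xs = r * (\<Prod>a\<leftarrow>xs. pochhammer a n)"
    for r :: complex and xs n
    by (induction xs arbitrary: r) (simp_all add: mult.assoc)
  then show ?thesis
    by (simp add: pFq_def eval_fps_def)
qed

text \<open>
  The continuous dual Hahn polynomial \<open>S\<^sub>n(x\<^sup>2; a, b, c)\<close>, as a function of \<open>x\<close>: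
  the last argument is \<open>x\<close>, not \<open>x\<^sup>2\<close>.
\<close>
definition cont_dual_Hahn ::
    "nat \<Rightarrow> complex \<Rightarrow> complex \<Rightarrow> complex \<Rightarrow> complex \<Rightarrow> complex" where
  "cont_dual_Hahn n a b c x =
     pochhammer (a + b) n * pochhammer (a + c) n *
     pFq [- of_nat n, a + \<i> * x, a - \<i> * x] [a + b, a + c] 1"

text \<open>
  Entries are counted with multiplicity: there are either no non-real entries, or exactly two,
  and these are conjugate to each other.
\<close>
definition real_or_conj_pair :: "complex list \<Rightarrow> bool" where
  "real_or_conj_pair xs \<longleftrightarrow>
     filter (\<lambda>z. z \<notin> \<real>) xs = [] \<or> (\<exists>z. filter (\<lambda>z. z \<notin> \<real>) xs = [z, cnj z])"

end

theory Submission
  imports Defs "HOL-Complex_Analysis.Cauchy_Integral_Theorem" "HOL-Real_Asymp.Real_Asymp"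
begin

text \<open>
  The \<open>n\<close>-th term of the \<open>\<^sub>2F\<^sub>2\<close> series multiplies the weight by \<open>(a + ix)\<^sub>n (a - ix)\<^sub>n\<close>, that is, it
  replaces \<open>a\<close> by \<open>a + n\<close>. If the polynomial, which is symmetric in its parameters, is expanded in base
  \<open>b\<close>, then all integrals reduce to the total mass
  \<open>I(a, b, d) = \<integral>\<^sub>\<real> weight = 4\<pi> \<Gamma>(a+b) \<Gamma>(a+d) \<Gamma>(b+d)\<close>; the finite sum is evaluated by Vandermonde's
  identity and the series in \<open>n\<close> by Kummer's transformation.

  For the total mass, a contour shift yields \<open>I(a+1, b, d) = (a+b)(a+d) I(a, b, d)\<close>, so that the quotient
  \<open>R\<close> of both sides is 1-periodic in each parameter. The quotient \<open>|\<Gamma>(s+iy)| / \<Gamma>(s)\<close> increases with \<open>s > 0\<close>,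
  which makes \<open>R\<close> nondecreasing, hence constant, in each parameter if these are real; one elementary
  integral gives the constant. For a conjugate pair \<open>s \<plusminus> i\<beta>\<close>, the weight is squeezed between multiples of
  the weight for \<open>\<beta> = 0\<close>, and the multiples are asymptotically correct when \<open>s\<close> is replaced by \<open>s + n\<close>.
\<close>

section \<open>Comparison of Gamma function values\<close>

text \<open>The factors (a + ix)_n (a - ix)_n already use up the shift of a. In base a the
  polynomial would add a second pair (a + ix)_j (a - ix)_j, and the product of both pairs is not a
  shifted weight; in base b the shifts of a and b are independent. The total mass is identified in
  the spirit of the Bohr-Mollerup theorem: the recurrence leaves a periodic factor open, and an
  order property removes it. Comparing two weights gives the desired inequality only up to a
  quotient of Gamma values; periodicity allows the parameters to be pushed to infinity, where this
  quotient tends to 1. All these inequalities come factor by factor from the limit of n! n^z /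
  (z)_(n+1), so Stirling's formula does not enter. Decay rates are kept rational: 9 < 3 pi bounds
  the rate of the six Gamma factors, 8 > 2 pi that of the hyperbolic sine.\<close>

lemma nonpos_Ints_Re_pos:
  fixes z :: complex
  assumes "Re z > 0"
  shows "z \<notin> \<int>\<^sub>\<le>\<^sub>0"
  using assms by (auto elim!: nonpos_Ints_cases)

lemma Gamma_neq_0_Re_pos: "Re z > 0 \<Longrightarrow> Gamma z \<noteq> (0::complex)"
  using nonpos_Ints_Re_pos by (simp add: Gamma_eq_zero_iff)

text \<open>In Gamma(z) = lim n! n^z / (z)_(n+1) the powers of n have modulus n^(Re z), so they
  agree on both sides once the real parts have equal sums. What remains is a comparison of the
  Pochhammer denominators, one index j at a time. Four factors suffice for every use; free places
  are filled with Gamma 1.\<close>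

lemma norm_Gamma_prod_le:
  fixes p1 p2 p3 p4 q1 q2 q3 q4 :: complex
  assumes pos: "Re p1 > 0" "Re p2 > 0" "Re p3 > 0" "Re p4 > 0"
      "Re q1 > 0" "Re q2 > 0" "Re q3 > 0" "Re q4 > 0"
    and Re_eq: "Re p1 + Re p2 + Re p3 + Re p4 = Re q1 + Re q2 + Re q3 + Re q4"
    and le: "\<And>j::nat.
      norm (q1 + of_nat j) * norm (q2 + of_nat j) * norm (q3 + of_nat j) * norm (q4 + of_nat j)
      \<le> norm (p1 + of_nat j) * norm (p2 + of_nat j) * norm (p3 + of_nat j) * norm (p4 + of_nat j)"
  shows "norm (Gamma p1) * norm (Gamma p2) * norm (Gamma p3) * norm (Gamma p4)
    \<le> norm (Gamma q1) * norm (Gamma q2) * norm (Gamma q3) * norm (Gamma q4)"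
proof (rule LIMSEQ_le)
  show "(\<lambda>n. norm (Gamma_series p1 n) * norm (Gamma_series p2 n) * norm (Gamma_series p3 n)
      * norm (Gamma_series p4 n)) \<longlonglongrightarrow>
      norm (Gamma p1) * norm (Gamma p2) * norm (Gamma p3) * norm (Gamma p4)"
    by (intro tendsto_intros)
  show "(\<lambda>n. norm (Gamma_series q1 n) * norm (Gamma_series q2 n) * norm (Gamma_series q3 n)
      * norm (Gamma_series q4 n)) \<longlonglongrightarrow>
      norm (Gamma q1) * norm (Gamma q2) * norm (Gamma q3) * norm (Gamma q4)"
    by (intro tendsto_intros)
  have poch: "norm (pochhammer z m) = (\<Prod>j<m. norm (z + of_nat j))" for z :: complex and m
    by (simp add: pochhammer_prod atLeast0LessThan flip: prod_norm)
  have poch_pos: "norm (pochhammer z m) > 0" if "Re z > 0" for z :: complex and m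
    using that nonpos_Ints_Re_pos pochhammer_eq_0_imp_nonpos_Int by force
  have ser: "norm (Gamma_series z n) = fact n * exp (Re z * ln (real n)) / norm (pochhammer z (n+1))"
    if "n > 0" for z :: complex and n
    using that by (simp add: Gamma_series_def norm_divide norm_mult)
  have "norm (Gamma_series p1 n) * norm (Gamma_series p2 n) * norm (Gamma_series p3 n)
      * norm (Gamma_series p4 n) \<le> norm (Gamma_series q1 n) * norm (Gamma_series q2 n)
      * norm (Gamma_series q3 n) * norm (Gamma_series q4 n)" if "n \<ge> 1" for n
  proof -
    have 1: "norm (Gamma_series z1 n) * norm (Gamma_series z2 n) * norm (Gamma_series z3 n)
      * norm (Gamma_series z4 n) = fact n ^ 4 * exp ((Re z1 + Re z2 + Re z3 + Re z4) * ln (real n)) /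
       (norm (pochhammer z1 (n+1)) * norm (pochhammer z2 (n+1)) * norm (pochhammer z3 (n+1)) *
         norm (pochhammer z4 (n+1)))" for z1 z2 z3 z4 :: complex
      using that by (simp add: ser ring_distribs exp_add power4_eq_xxxx)
    have 2: "norm (pochhammer q1 (n+1)) * norm (pochhammer q2 (n+1)) * norm (pochhammer q3 (n+1)) *
         norm (pochhammer q4 (n+1)) \<le> norm (pochhammer p1 (n+1)) * norm (pochhammer p2 (n+1)) *
         norm (pochhammer p3 (n+1)) * norm (pochhammer p4 (n+1))"
      unfolding poch prod.distrib[symmetric] by (intro prod_mono conjI le mult_nonneg_nonneg) auto
    show ?thesis
      unfolding 1 Re_eq
      by (intro divide_left_mono 2 mult_pos_pos poch_pos pos) auto
  qed
  then show "\<exists>N. \<forall>n\<ge>N. norm (Gamma_series p1 n) * norm (Gamma_series p2 n) * norm (Gamma_series p3 n)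
      * norm (Gamma_series p4 n) \<le> norm (Gamma_series q1 n) * norm (Gamma_series q2 n)
      * norm (Gamma_series q3 n) * norm (Gamma_series q4 n)" by blast
qed

lemma norm_Gamma_of_real: "x > 0 \<Longrightarrow> norm (Gamma (complex_of_real x)) = Gamma x"
  by (simp add: Gamma_complex_of_real)

text \<open>Each factor of the product contributes |u + iy| / u, whose square 1 + y^2 / u^2
  decreases in u; the Gamma function has these factors in the denominator.\<close>

lemma norm_Gamma_vertical_mono:
  assumes "0 < s" "s \<le> t"
  shows "norm (Gamma (Complex s y)) * Gamma t \<le> norm (Gamma (Complex t y)) * Gamma s"
proof -
  have "norm (Gamma (Complex s y)) * norm (Gamma (complex_of_real t)) * norm (Gamma (1::complex)) * norm (Gamma (1::complex))
    \<le> norm (Gamma (Complex t y)) * norm (Gamma (complex_of_real s)) * norm (Gamma (1::complex)) * norm (Gamma (1::complex))"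
  proof (rule norm_Gamma_prod_le)
    fix j :: nat
    define u v where "u = s + j" and "v = t + j"
    have uv: "0 < u" "u \<le> v" using assms by (auto simp: u_def v_def)
    have [simp]: "Complex s y + of_nat j = Complex u y" "Complex t y + of_nat j = Complex v y"
      "complex_of_real s + of_nat j = of_real u" "complex_of_real t + of_nat j = of_real v"
      by (auto simp: u_def v_def complex_eq_iff)
    have "(norm (Complex v y) * norm (complex_of_real u))\<^sup>2 \<le> (norm (Complex u y) * norm (complex_of_real v))\<^sup>2"
    proof -
      have "u\<^sup>2 * y\<^sup>2 \<le> v\<^sup>2 * y\<^sup>2" using uv by (intro mult_right_mono power_mono) auto
      then show ?thesis using uv by (simp add: power_mult_distrib cmod_power2 algebra_simps)
    qed
    then have "norm (Complex v y) * norm (complex_of_real u) \<le> norm (Complex u y) * norm (complex_of_real v)"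
      by (rule power2_le_imp_le) auto
    then show "norm (Complex t y + of_nat j) * norm (complex_of_real s + of_nat j) * norm ((1::complex) + of_nat j) * norm ((1::complex) + of_nat j)
      \<le> norm (Complex s y + of_nat j) * norm (complex_of_real t + of_nat j) * norm ((1::complex) + of_nat j) * norm ((1::complex) + of_nat j)"
      by (intro mult_right_mono) auto
  qed (use assms in auto)
  then show ?thesis using assms by (simp add: norm_Gamma_of_real)
qed

text \<open>Moving z up and down by \<beta> lowers |Gamma z|^2 by a factor that is smallest for real
  z, where equality holds. Factor by factor this is |w^2 + \<beta>^2| \<le> |w|^2 + \<beta>^2
  together with Re w \<le> |w|. The bound is uniform on the vertical line through z, as needed under
  the integral.\<close>

lemma norm_Gamma_shift_ge:
  fixes z :: complex
  assumes "Re z > 0"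
  shows "(norm (Gamma z))\<^sup>2 * (norm (Gamma (Complex (Re z) \<beta>)))\<^sup>2
    \<le> norm (Gamma (z + \<i> * of_real \<beta>)) * norm (Gamma (z - \<i> * of_real \<beta>)) * (Gamma (Re z))\<^sup>2"
proof -
  define A where "A = Re z"
  have cnj: "norm (Gamma (Complex A (-\<beta>))) = norm (Gamma (Complex A \<beta>))"
    by (metis cnj_Gamma complex_cnj complex_mod_cnj)
  have "norm (Gamma z) * norm (Gamma z) * norm (Gamma (Complex A \<beta>)) * norm (Gamma (Complex A (-\<beta>)))
     \<le> norm (Gamma (z + \<i> * of_real \<beta>)) * norm (Gamma (z - \<i> * of_real \<beta>)) *
        norm (Gamma (complex_of_real A)) * norm (Gamma (complex_of_real A))"
  proof (rule norm_Gamma_prod_le)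
    fix j :: nat
    define w where "w = z + j"
    define u where "u = A + j"
    have u: "u > 0" using assms by (simp add: u_def A_def)
    have uw: "u = Re w" by (simp add: u_def w_def A_def)
    have le: "u \<le> norm w" unfolding uw by (rule complex_Re_le_cmod)
    have 1: "norm (w + \<i> * of_real \<beta>) * norm (w - \<i> * of_real \<beta>) = norm (w\<^sup>2 + of_real (\<beta>\<^sup>2))"
      by (simp flip: norm_mult add: algebra_simps power2_eq_square)
    have 2: "norm (Complex u \<beta>) * norm (Complex u (-\<beta>)) = u\<^sup>2 + \<beta>\<^sup>2"
      by (simp add: cmod_def)
    have "norm (w\<^sup>2 + of_real (\<beta>\<^sup>2)) \<le> (norm w)\<^sup>2 + \<beta>\<^sup>2"
      by (rule norm_triangle_le) (simp add: norm_power)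
    then have "norm (w\<^sup>2 + of_real (\<beta>\<^sup>2)) * u\<^sup>2 \<le> ((norm w)\<^sup>2 + \<beta>\<^sup>2) * u\<^sup>2"
      by (intro mult_right_mono) auto
    also have "\<dots> \<le> (norm w)\<^sup>2 * (u\<^sup>2 + \<beta>\<^sup>2)"
    proof -
      have "\<beta>\<^sup>2 * u\<^sup>2 \<le> \<beta>\<^sup>2 * (norm w)\<^sup>2" using u le by (intro mult_left_mono power_mono) auto
      then show ?thesis by (simp add: algebra_simps)
    qed
    finally have le: "norm (w + \<i> * of_real \<beta>) * norm (w - \<i> * of_real \<beta>) * u * u
      \<le> norm w * norm w * norm (Complex u \<beta>) * norm (Complex u (-\<beta>))"
      unfolding 1 mult.assoc 2 by (simp add: power2_eq_square)
    have eqs: "z + \<i> * of_real \<beta> + of_nat j = w + \<i> * of_real \<beta>"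
      "z - \<i> * of_real \<beta> + of_nat j = w - \<i> * of_real \<beta>" "z + of_nat j = w"
      "complex_of_real A + of_nat j = of_real u" "Complex A \<beta> + of_nat j = Complex u \<beta>"
      "Complex A (-\<beta>) + of_nat j = Complex u (-\<beta>)"
      by (auto simp: w_def u_def complex_eq_iff)
    show "norm (z + \<i> * of_real \<beta> + of_nat j) * norm (z - \<i> * of_real \<beta> + of_nat j) *
        norm (complex_of_real A + of_nat j) * norm (complex_of_real A + of_nat j)
      \<le> norm (z + of_nat j) * norm (z + of_nat j) * norm (Complex A \<beta> + of_nat j) *
         norm (Complex A (-\<beta>) + of_nat j)"
      using le u by (simp only: eqs norm_of_real abs_of_pos)
  qed (use assms in \<open>auto simp: A_def\<close>)
  then show ?thesis using assms cnj by (simp add: norm_Gamma_of_real power2_eq_square A_def mult_ac)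
qed

text \<open>The counterpart uses |w^2 + \<beta>^2| \<ge> |w|^2 - \<beta>^2. The right-hand side then
  factors as (u + \<beta>)(u - \<beta>), so the imaginary shift turns into a real one; this is why
  |\<beta>| has to stay below the real part.\<close>

lemma norm_Gamma_shift_le:
  fixes z :: complex
  assumes "\<bar>\<beta>\<bar> < Re z"
  shows "norm (Gamma (z + \<i> * of_real \<beta>)) * norm (Gamma (z - \<i> * of_real \<beta>)) * (Gamma (Re z))\<^sup>2
    \<le> (norm (Gamma z))\<^sup>2 * Gamma (Re z + \<beta>) * Gamma (Re z - \<beta>)"
proof -
  define A where "A = Re z"
  have "norm (Gamma (z + \<i> * of_real \<beta>)) * norm (Gamma (z - \<i> * of_real \<beta>)) *
        norm (Gamma (complex_of_real A)) * norm (Gamma (complex_of_real A))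
      \<le> norm (Gamma z) * norm (Gamma z) * norm (Gamma (complex_of_real (A + \<beta>))) *
        norm (Gamma (complex_of_real (A - \<beta>)))"
  proof (rule norm_Gamma_prod_le)
    fix j :: nat
    define w where "w = z + j"
    define u where "u = A + j"
    have u: "u > \<bar>\<beta>\<bar>" using assms by (simp add: u_def A_def)
    have uw: "u = Re w" by (simp add: u_def w_def A_def)
    have le: "u \<le> norm w" unfolding uw by (rule complex_Re_le_cmod)
    have 1: "norm (w + \<i> * of_real \<beta>) * norm (w - \<i> * of_real \<beta>) = norm (w\<^sup>2 + of_real (\<beta>\<^sup>2))"
      by (simp flip: norm_mult add: algebra_simps power2_eq_square)
    have "(norm w)\<^sup>2 - \<beta>\<^sup>2 \<le> norm (w\<^sup>2 + of_real (\<beta>\<^sup>2))"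
      using norm_diff_ineq[of "w\<^sup>2" "of_real (\<beta>\<^sup>2)"] by (simp add: norm_power)
    then have "((norm w)\<^sup>2 - \<beta>\<^sup>2) * u\<^sup>2 \<le> norm (w\<^sup>2 + of_real (\<beta>\<^sup>2)) * u\<^sup>2"
      by (intro mult_right_mono) auto
    moreover have "(norm w)\<^sup>2 * (u\<^sup>2 - \<beta>\<^sup>2) \<le> ((norm w)\<^sup>2 - \<beta>\<^sup>2) * u\<^sup>2"
    proof -
      have "\<beta>\<^sup>2 * u\<^sup>2 \<le> \<beta>\<^sup>2 * (norm w)\<^sup>2" using u le by (intro mult_left_mono power_mono) auto
      then show ?thesis by (simp add: algebra_simps)
    qed
    ultimately have le: "norm w * norm w * (u + \<beta>) * (u - \<beta>) \<le>
        norm (w + \<i> * of_real \<beta>) * norm (w - \<i> * of_real \<beta>) * u * u"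
      unfolding 1 by (simp add: power2_eq_square algebra_simps)
    have eqs: "z + \<i> * of_real \<beta> + of_nat j = w + \<i> * of_real \<beta>"
      "z - \<i> * of_real \<beta> + of_nat j = w - \<i> * of_real \<beta>" "z + of_nat j = w"
      "complex_of_real A + of_nat j = of_real u" 
      "complex_of_real (A + \<beta>) + of_nat j = of_real (u + \<beta>)"
      "complex_of_real (A - \<beta>) + of_nat j = of_real (u - \<beta>)"
      by (auto simp: w_def u_def complex_eq_iff)
    show "norm (z + of_nat j) * norm (z + of_nat j) *
         norm (complex_of_real (A + \<beta>) + of_nat j) * norm (complex_of_real (A - \<beta>) + of_nat j)
      \<le> norm (z + \<i> * of_real \<beta> + of_nat j) * norm (z - \<i> * of_real \<beta> + of_nat j) *
        norm (complex_of_real A + of_nat j) * norm (complex_of_real A + of_nat j)"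
    proof -
      have "u > 0" "u + \<beta> > 0" "u - \<beta> > 0" using u by auto
      then show ?thesis using le by (simp only: eqs norm_of_real abs_of_pos)
    qed
  qed (use assms in \<open>auto simp: A_def\<close>)
  then show ?thesis using assms
    by (simp add: norm_Gamma_of_real power2_eq_square A_def mult_ac del: of_real_add of_real_diff)
qed

section \<open>Exponential decay of the Gamma function on vertical lines\<close>

lemma power_le_fact_exp:
  fixes t \<epsilon> :: real
  assumes "t \<ge> 0" "\<epsilon> > 0"
  shows "t ^ n \<le> fact n / \<epsilon> ^ n * exp (\<epsilon> * t)"
proof -
  have "(\<epsilon> * t) ^ n / fact n \<le> exp (\<epsilon> * t)"
    using assms summable_exp_generic[of "\<epsilon> * t"]
      sum_le_suminf[of "\<lambda>n. (\<epsilon> * t) ^ n /\<^sub>R fact n" "{n}"]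
    by (simp add: exp_def divide_inverse mult.commute)
  then show ?thesis using assms by (simp add: power_mult_distrib field_simps)
qed

lemma norm_pochhammer_le: "norm (pochhammer (z::complex) n) \<le> (norm z + n) ^ n"
proof -
  have "norm (pochhammer z n) = (\<Prod>j<n. norm (z + of_nat j))"
    by (simp add: pochhammer_prod atLeast0LessThan flip: prod_norm)
  also have "\<dots> \<le> (\<Prod>j<n. norm z + n)"
  proof (intro prod_mono conjI)
    fix j assume "j \<in> {..<n}"
    then show "norm (z + of_nat j) \<le> norm z + n"
      using norm_triangle_ineq[of z "of_nat j"] by simp
  qed auto
  finally show ?thesis by simp
qed

text \<open>On the line Re z = 1/2 conjugation is z -> 1 - z, so the squared modulus is the
  left-hand side of the reflection formula.\<close>

lemma norm_Gamma_half_vertical: "(norm (Gamma (Complex (1/2) y)))\<^sup>2 = pi / cosh (pi * y)"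
proof -
  define z where "z = Complex (1/2) y"
  have "cnj z = 1 - z" by (simp add: z_def complex_eq_iff)
  then have "of_real ((norm (Gamma z))\<^sup>2) = Gamma z * Gamma (1 - z)"
    by (metis cnj_Gamma complex_norm_square of_real_power)
  also have "\<dots> = of_real pi / sin (of_real pi * z)"
    by (rule Gamma_reflection_complex)
  also have "of_real pi * z = of_real (pi / 2) + \<i> * of_real (pi * y)"
    by (simp add: z_def complex_eq_iff)
  also have "sin \<dots> = of_real (cosh (pi * y))"
    using cosh_real[of "pi * y"]
    by (simp add: sin_add sin_of_real cos_of_real cosh_field_def exp_minus mult.assoc)
  finally have "complex_of_real ((norm (Gamma z))\<^sup>2) = of_real (pi / cosh (pi * y))"
    by simp
  then show ?thesis unfolding z_def of_real_eq_iff .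
qed

text \<open>The exact rate pi / 2 is known on Re z = 1/2. The functional equation carries it to Re z
  = N + 1/2 at the cost of a polynomial in |Im z|, which the gap \<open>\<epsilon>\<close> between
  pi / 2 and \<theta> absorbs. Monotonicity in the real part then covers the whole strip to the left
  of that line, uniformly since Gamma is bounded on [l, u].\<close>

lemma norm_Gamma_vertical_decay:
  fixes l u \<theta> :: real
  assumes "0 < l" "0 \<le> \<theta>" "\<theta> < pi / 2"
  obtains C where "C > 0"
    "\<And>z. l \<le> Re z \<Longrightarrow> Re z \<le> u \<Longrightarrow> norm (Gamma z) \<le> C * exp (- \<theta> * \<bar>Im z\<bar>)"
proof -
  obtain N :: nat where N: "u \<le> N" using real_arch_simple by blast
  have "continuous_on {l..u} (Gamma :: real \<Rightarrow> real)"
    using \<open>0 < l\<close> by (intro continuous_on_Gamma) (auto elim!: nonpos_Ints_cases)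
  then have "bounded (Gamma ` {l..u})"
    by (intro compact_imp_bounded compact_continuous_image) auto
  then obtain K where K: "K > 0" "\<And>s. l \<le> s \<Longrightarrow> s \<le> u \<Longrightarrow> norm (Gamma s) \<le> K"
    unfolding bounded_pos by auto
  define \<epsilon> where "\<epsilon> = pi / 2 - \<theta>"
  have \<epsilon>: "\<epsilon> > 0" using assms by (simp add: \<epsilon>_def)
  define D where "D = sqrt (2 * pi) * (fact N / \<epsilon> ^ N * exp (\<epsilon> * (N + 1)))"
  have D: "D > 0" using \<epsilon> by (simp add: D_def)
  have half: "norm (Gamma (Complex (1/2) y)) \<le> sqrt (2 * pi) * exp (- pi / 2 * \<bar>y\<bar>)" for y
  proof -
    have "pi / cosh (pi * y) \<le> 2 * pi * exp (- pi * \<bar>y\<bar>)"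
    proof -
      have "exp (pi * \<bar>y\<bar>) \<le> exp (pi * y) + exp (- (pi * y))"
        by (cases "y \<ge> 0") (auto simp: abs_if)
      then have "exp (pi * \<bar>y\<bar>) / 2 \<le> cosh (pi * y)" by (simp add: cosh_field_def)
      then have "pi / cosh (pi * y) \<le> pi / (exp (pi * \<bar>y\<bar>) / 2)"
        by (intro divide_left_mono) auto
      then show ?thesis by (simp add: exp_minus field_simps)
    qed
    also have "\<dots> = (sqrt (2 * pi) * exp (- pi / 2 * \<bar>y\<bar>))\<^sup>2"
      by (simp add: power_mult_distrib real_sqrt_mult flip: exp_double)
    finally show ?thesis
      unfolding norm_Gamma_half_vertical[symmetric] by (rule power2_le_imp_le) auto
  qed
  have int: "norm (Gamma (Complex (N + 1/2) y)) \<le> D * exp (- \<theta> * \<bar>y\<bar>)" for y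
  proof -
    define z where "z = Complex (1/2) y"
    have zN: "Complex (N + 1/2) y = z + of_nat N" by (simp add: z_def complex_eq_iff)
    have "Re z > 0" by (simp add: z_def)
    then have "Gamma (z + of_nat N) = pochhammer z N * Gamma z"
      using pochhammer_Gamma[of z N] Gamma_neq_0_Re_pos[of z] nonpos_Ints_Re_pos by simp
    then have "norm (Gamma (Complex (N + 1/2) y)) = norm (pochhammer z N) * norm (Gamma z)"
      by (simp add: zN norm_mult)
    also have "\<dots> \<le> (norm z + N) ^ N * (sqrt (2 * pi) * exp (- pi / 2 * \<bar>y\<bar>))"
      using half[of y] by (intro mult_mono norm_pochhammer_le) (auto simp: z_def)
    also have "(norm z + N) ^ N \<le> (N + 1 + \<bar>y\<bar>) ^ N"
      using cmod_le[of z] by (intro power_mono) (auto simp: z_def)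
    also have "\<dots> \<le> fact N / \<epsilon> ^ N * exp (\<epsilon> * (N + 1 + \<bar>y\<bar>))"
      using \<epsilon> by (intro power_le_fact_exp) auto
    also have "fact N / \<epsilon> ^ N * exp (\<epsilon> * (N + 1 + \<bar>y\<bar>)) * (sqrt (2 * pi) * exp (- pi / 2 * \<bar>y\<bar>))
      = D * exp (\<epsilon> * \<bar>y\<bar> + - pi / 2 * \<bar>y\<bar>)"
      unfolding D_def distrib_left exp_add by (simp add: mult_ac)
    also have "\<epsilon> * \<bar>y\<bar> + - pi / 2 * \<bar>y\<bar> = - \<theta> * \<bar>y\<bar>"
      by (simp add: \<epsilon>_def algebra_simps)
    finally show ?thesis by (simp add: mult_right_mono)
  qed
  define C where "C = K * D / Gamma (N + 1/2 :: real)"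
  show ?thesis
  proof
    show "C > 0" using K D by (auto simp: C_def)
    fix z assume z: "l \<le> Re z" "Re z \<le> u"
    have G: "Gamma (N + 1/2 :: real) > 0" by (intro Gamma_real_pos) auto
    have "norm (Gamma z) * Gamma (N + 1/2) \<le> norm (Gamma (Complex (N + 1/2) (Im z))) * Gamma (Re z)"
      using norm_Gamma_vertical_mono[of "Re z" "N + 1/2" "Im z"] z N assms by auto
    also have "\<dots> \<le> D * exp (- \<theta> * \<bar>Im z\<bar>) * K"
      using K(2)[of "Re z"] z D assms by (intro mult_mono int) auto
    finally show "norm (Gamma z) \<le> C * exp (- \<theta> * \<bar>Im z\<bar>)"
      using G by (simp add: C_def field_simps)
  qed
qed

lemma integrable_exp_minus_abs:
  assumes "\<delta> > 0"
  shows "integrable lborel (\<lambda>x::real. exp (- \<delta> * \<bar>x\<bar>))"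
proof -
  have pos: "set_integrable lborel {0..} (\<lambda>x::real. exp (- \<delta> * x))"
  proof -
    have "(\<integral>\<^sup>+x. ennreal (exp (- \<delta> * x)) * indicator {0..} x \<partial>lborel) = ennreal (0 - (- exp (- \<delta> * 0) / \<delta>))"
    proof (rule nn_integral_FTC_atLeast)
      show "((\<lambda>x. - exp (- \<delta> * x) / \<delta>) has_real_derivative exp (- \<delta> * x)) (at x)" for x
        using assms by (auto intro!: derivative_eq_intros)
      show "((\<lambda>x. - exp (- \<delta> * x) / \<delta>) \<longlongrightarrow> 0) at_top"
        using assms by real_asymp
    qed auto
    moreover have "(\<integral>\<^sup>+x. ennreal (indicator {0..} x *\<^sub>R exp (- \<delta> * x)) \<partial>lborel) =
       (\<integral>\<^sup>+x. ennreal (exp (- \<delta> * x)) * indicator {0..} x \<partial>lborel)"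
      by (intro nn_integral_cong) (auto simp: indicator_def)
    ultimately show ?thesis
      unfolding set_integrable_def
      by (intro integrableI_nn_integral_finite[where x = "0 - (- exp (- \<delta> * 0) / \<delta>)"])
        (auto simp: indicator_def)
  qed
  have neg: "set_integrable lborel {..0} (\<lambda>x::real. exp (\<delta> * x))"
    using lborel_integrable_real_affine[OF pos[unfolded set_integrable_def], of "-1" 0]
    unfolding set_integrable_def indicator_def by (simp del: scaleR_conv_of_real)
  have "set_integrable lborel ({0..} \<union> {..0}) (\<lambda>x::real. exp (- \<delta> * \<bar>x\<bar>))"
  proof (rule set_integrable_Un)
    show "set_integrable lborel {0..} (\<lambda>x::real. exp (- \<delta> * \<bar>x\<bar>))"
      using pos by (subst set_integrable_cong[OF refl]) (auto simp: abs_if)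
    show "set_integrable lborel {..0} (\<lambda>x::real. exp (- \<delta> * \<bar>x\<bar>))"
      using neg by (subst set_integrable_cong[OF refl]) (auto simp: abs_if)
  qed auto
  moreover have "{0..} \<union> {..0} = (UNIV :: real set)" by auto
  ultimately show ?thesis by (simp add: set_integrable_def)
qed

lemma integrable_exp_decay:
  fixes f :: "real \<Rightarrow> complex"
  assumes "\<delta> > 0" "continuous_on UNIV f" "\<And>x. norm (f x) \<le> C * exp (- \<delta> * \<bar>x\<bar>)"
  shows "integrable lborel f"
proof (rule Bochner_Integration.integrable_bound)
  show "integrable lborel (\<lambda>x. C * exp (- \<delta> * \<bar>x\<bar>))"
    using assms(1) by (intro integrable_mult_right integrable_exp_minus_abs)
  show "f \<in> borel_measurable lborel"
    using borel_measurable_continuous_onI[OF assms(2)] by simp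
  show "AE x in lborel. norm (f x) \<le> norm (C * exp (- \<delta> * \<bar>x\<bar>))"
    using assms(3) by (intro AE_I2) (metis norm_ge_zero order.trans real_norm_def abs_ge_self)
qed

section \<open>A contour shift for odd functions\<close>

text \<open>
  A primitive \<open>G\<close> of an odd function is even, so \<open>G (\<sigma> + \<i>T) - G (\<sigma> - \<i>T) = G (\<sigma> + \<i>T) - G (-\<sigma> + \<i>T)\<close>
  is an integral of \<open>h\<close> over a horizontal segment of fixed length far away from the real axis.
\<close>
lemma integral_vertical_odd_eq_0:
  fixes h :: "complex \<Rightarrow> complex"
  assumes \<sigma>: "0 \<le> \<sigma>" "\<sigma> < r" and hol: "h holomorphic_on {z. \<bar>Re z\<bar> < r}"
    and odd: "\<And>z. h (- z) = - h z"
    and \<delta>: "\<delta> > 0"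
    and decay: "\<And>z. \<bar>Re z\<bar> \<le> \<sigma> \<Longrightarrow> norm (h z) \<le> C * exp (- \<delta> * \<bar>Im z\<bar>)"
  shows "integrable lborel (\<lambda>t. h (Complex \<sigma> t))" "(LBINT t. h (Complex \<sigma> t)) = 0"
proof -
  define S where "S = {z. \<bar>Re z\<bar> < r}"
  have S_eq: "S = {z. Re z < r} \<inter> {z. Re z > - r}" by (auto simp: S_def)
  have "convex S" unfolding S_eq by (intro convex_Int convex_halfspace_Re_lt convex_halfspace_Re_gt)
  have "open S" unfolding S_eq by (intro open_Int open_halfspace_Re_lt open_halfspace_Re_gt)
  obtain G0 where "\<And>z. z \<in> S \<Longrightarrow> (G0 has_field_derivative h z) (at z within S)"
    using holomorphic_convex_primitive'[OF \<open>convex S\<close> \<open>open S\<close>, of h] hol by (auto simp: S_def)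
  then have G0: "(G0 has_field_derivative h z) (at z)" if "z \<in> S" for z
    using that at_within_open[OF that \<open>open S\<close>] by metis
  have mem: "Complex s t \<in> S" if "\<bar>s\<bar> \<le> \<sigma>" for s t
    using that \<sigma> by (simp add: S_def)
  have cont: "continuous_on UNIV (\<lambda>t. h (Complex \<sigma> t))"
  proof (rule continuous_on_compose2[of S h])
    show "continuous_on S h" using hol by (simp add: S_def holomorphic_on_imp_continuous_on)
    show "continuous_on UNIV (\<lambda>t. Complex \<sigma> t)" by (intro continuous_intros)
  qed (use \<sigma> in \<open>auto simp: S_def\<close>)
  show int: "integrable lborel (\<lambda>t. h (Complex \<sigma> t))"
    using decay[of "Complex \<sigma> _"] \<sigma> by (intro integrable_exp_decay[OF \<delta> cont, of C]) auto
  have even: "G0 (- z) = G0 z" if "z \<in> S" for z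
  proof -
    have "\<exists>c. \<forall>z\<in>S. G0 (- z) - G0 z = c"
    proof (rule has_field_derivative_zero_constant)
      fix z assume z: "z \<in> S"
      then have "- z \<in> S" by (simp add: S_def)
      have "((\<lambda>z. G0 (- z)) has_field_derivative h (- z) * (- 1)) (at z)"
        by (rule DERIV_chain2[where g = uminus, OF G0[OF \<open>- z \<in> S\<close>]]) (auto intro!: derivative_eq_intros)
      from DERIV_diff[OF this G0[OF z]]
      have "((\<lambda>z. G0 (- z) - G0 z) has_field_derivative 0) (at z)" by (simp add: odd)
      then show "((\<lambda>z. G0 (- z) - G0 z) has_field_derivative 0) (at z within S)"
        by (rule has_field_derivative_at_within)
    qed fact
    then obtain c where c: "\<And>z. z \<in> S \<Longrightarrow> G0 (- z) - G0 z = c" by blast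
    have "c = 0" using c[of 0] \<sigma> by (simp add: S_def)
    then show ?thesis using c[OF that] by simp
  qed
  have FTC: "(LBINT t. indicator {- T..T} t *\<^sub>R h (Complex \<sigma> t)) =
     - \<i> * (G0 (Complex \<sigma> T) - G0 (Complex \<sigma> (- T)))" if "T \<ge> 0" for T
  proof -
    have "(LBINT t. indicator {- T..T} t *\<^sub>R h (Complex \<sigma> t)) =
       - \<i> * G0 (Complex \<sigma> T) - (- \<i> * G0 (Complex \<sigma> (- T)))"
    proof (rule integral_FTC_atLeastAtMost)
      show "((\<lambda>t. - \<i> * G0 (Complex \<sigma> t)) has_vector_derivative h (Complex \<sigma> t)) (at t within {- T..T})" for t
      proof -
        have "((\<lambda>t. Complex \<sigma> t) has_vector_derivative \<i>) (at t within {- T..T})"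
          unfolding Complex_eq by (auto intro!: derivative_eq_intros)
        from field_vector_diff_chain_within[OF this has_field_derivative_at_within[OF G0[OF mem]]]
        have "((\<lambda>t. G0 (Complex \<sigma> t)) has_vector_derivative \<i> * h (Complex \<sigma> t)) (at t within {- T..T})"
          using \<sigma> by (simp add: o_def)
        from has_vector_derivative_mult_right[OF this, of "- \<i>"] show ?thesis by simp
      qed
      show "continuous_on {- T..T} (\<lambda>t. h (Complex \<sigma> t))"
        using cont by (rule continuous_on_subset) auto
    qed (use that in auto)
    then show ?thesis by (simp add: algebra_simps)
  qed
  have bound: "norm (LBINT t. indicator {- T..T} t *\<^sub>R h (Complex \<sigma> t)) \<le> C * exp (- \<delta> * T) * (2 * \<sigma>)"
    if "T \<ge> 0" for T
  proof -
    have "G0 (Complex \<sigma> (- T)) = G0 (Complex (- \<sigma>) T)"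
    proof -
      have "Complex (- \<sigma>) T = - Complex \<sigma> (- T)" by (simp add: complex_eq_iff)
      then show ?thesis using even[OF mem, of \<sigma> "- T"] \<sigma> by simp
    qed
    then have "norm (LBINT t. indicator {- T..T} t *\<^sub>R h (Complex \<sigma> t)) =
      norm (G0 (Complex \<sigma> T) - G0 (Complex (- \<sigma>) T))"
      unfolding FTC[OF that] by (simp add: norm_mult)
    also have "\<dots> \<le> C * exp (- \<delta> * T) * norm (Complex \<sigma> T - Complex (- \<sigma>) T)"
    proof -
      \<comment> \<open>The horizontal segment from -\<sigma> + iT to \<sigma> + iT, written with
        half-planes so that its convexity is immediate. It has length 2\<sigma> for every T, while h
        is exponentially small on it.\<close>
      define L where "L = {z. Re z \<le> \<sigma>} \<inter> {z. Re z \<ge> - \<sigma>} \<inter> ({z. Im z \<le> T} \<inter> {z. Im z \<ge> T})"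
      have L: "convex L" unfolding L_def
        by (intro convex_Int convex_halfspace_Re_le convex_halfspace_Re_ge
              convex_halfspace_Im_le convex_halfspace_Im_ge)
      have "(G0 has_field_derivative h z) (at z within L)" if "z \<in> L" for z
        using that \<sigma> by (intro has_field_derivative_at_within[OF G0]) (auto simp: L_def S_def)
      moreover have "norm (h z) \<le> C * exp (- \<delta> * T)" if "z \<in> L" for z
        using that decay[of z] \<open>T \<ge> 0\<close> by (auto simp: L_def)
      moreover have "Complex \<sigma> T \<in> L" "Complex (- \<sigma>) T \<in> L" using \<sigma> by (auto simp: L_def)
      ultimately show ?thesis by (rule field_differentiable_bound[OF L])
    qed
    also have "norm (Complex \<sigma> T - Complex (- \<sigma>) T) = 2 * \<sigma>"
      using \<sigma> by (simp add: cmod_def real_sqrt_mult)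
    finally show ?thesis .
  qed
  have "(\<lambda>n. LBINT t. indicator {- real n..real n} t *\<^sub>R h (Complex \<sigma> t)) \<longlonglongrightarrow> (LBINT t. h (Complex \<sigma> t))"
  proof (rule integral_dominated_convergence[where w = "\<lambda>t. norm (h (Complex \<sigma> t))"])
    show "(\<lambda>t. h (Complex \<sigma> t)) \<in> borel_measurable lborel" using int by (rule borel_measurable_integrable)
    show "(\<lambda>t. indicator {- real n..real n} t *\<^sub>R h (Complex \<sigma> t)) \<in> borel_measurable lborel" for n
      using borel_measurable_integrable[OF int] by (intro borel_measurable_scaleR) auto
    show "AE t in lborel. (\<lambda>n. indicator {- real n..real n} t *\<^sub>R h (Complex \<sigma> t)) \<longlonglongrightarrow> h (Complex \<sigma> t)"
    proof (intro AE_I2 tendsto_eventually)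
      fix t :: real
      obtain N :: nat where "\<bar>t\<bar> \<le> N" using real_arch_simple by blast
      then show "\<forall>\<^sub>F n in sequentially. indicator {- real n..real n} t *\<^sub>R h (Complex \<sigma> t) = h (Complex \<sigma> t)"
        by (intro eventually_sequentiallyI[of N]) (auto simp: indicator_def)
    qed
  qed (use int in \<open>auto simp: indicator_def\<close>)
  moreover have "(\<lambda>n. LBINT t. indicator {- real n..real n} t *\<^sub>R h (Complex \<sigma> t)) \<longlonglongrightarrow> 0"
  proof (rule Lim_null_comparison)
    show "\<forall>\<^sub>F n in sequentially. norm (LBINT t. indicator {- real n..real n} t *\<^sub>R h (Complex \<sigma> t))
       \<le> C * exp (- \<delta> * real n) * (2 * \<sigma>)"
      using bound by simp
    show "(\<lambda>n. C * exp (- \<delta> * real n) * (2 * \<sigma>)) \<longlonglongrightarrow> 0"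
      using \<delta> by real_asymp
  qed
  ultimately show "(LBINT t. h (Complex \<sigma> t)) = 0" by (rule LIMSEQ_unique)
qed

section \<open>The total mass of the weight\<close>

text \<open>For real p and u = ix this is |Gamma(p + ix)|^2, but unlike the modulus it is
  holomorphic in u, which the contour shift requires.\<close>

definition Gamma_pair :: "complex \<Rightarrow> complex \<Rightarrow> complex" where
  "Gamma_pair p u = Gamma (p + u) * Gamma (p - u)"

lemma Gamma_pair_minus [simp]: "Gamma_pair p (- u) = Gamma_pair p u"
  by (simp add: Gamma_pair_def mult.commute)

lemma Gamma_pair_plus_1:
  assumes "\<bar>Re u\<bar> < Re p"
  shows "Gamma_pair (p + 1) u = (p\<^sup>2 - u\<^sup>2) * Gamma_pair p u"
proof -
  have "Gamma (p + u + 1) = (p + u) * Gamma (p + u)" "Gamma (p - u + 1) = (p - u) * Gamma (p - u)"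
    using assms by (intro Gamma_plus1 nonpos_Ints_Re_pos; simp)+
  moreover have "p + 1 + u = p + u + 1" "p + 1 - u = p - u + 1" by simp_all
  ultimately have "Gamma_pair (p + 1) u = ((p + u) * Gamma (p + u)) * ((p - u) * Gamma (p - u))"
    by (simp only: Gamma_pair_def)
  then show ?thesis
    by (simp add: Gamma_pair_def algebra_simps power2_eq_square)
qed

lemma holomorphic_on_Gamma_pair:
  "Gamma_pair p holomorphic_on {u. \<bar>Re u\<bar> < Re p}"
proof -
  have "(\<lambda>u. Gamma (p + u) * Gamma (p - u)) holomorphic_on {u. \<bar>Re u\<bar> < Re p}"
    by (intro holomorphic_intros nonpos_Ints_Re_pos) auto
  then show ?thesis by (simp add: Gamma_pair_def[abs_def])
qed

lemma Gamma_pair_decay: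
  assumes "0 \<le> \<theta>" "\<theta> < pi / 2" "\<sigma> < Re p"
  obtains C where "C > 0"
    "\<And>u. \<bar>Re u\<bar> \<le> \<sigma> \<Longrightarrow> norm (Gamma_pair p u) \<le> C * exp (- 2 * \<theta> * \<bar>Im u\<bar>)"
proof -
  obtain C where C: "C > 0"
    "\<And>z. Re p - \<sigma> \<le> Re z \<Longrightarrow> Re z \<le> Re p + \<sigma> \<Longrightarrow> norm (Gamma z) \<le> C * exp (- \<theta> * \<bar>Im z\<bar>)"
    using norm_Gamma_vertical_decay[of "Re p - \<sigma>" \<theta> "Re p + \<sigma>"] assms by auto
  show ?thesis
  proof
    show "C * C > 0" using C by simp
    fix u assume u: "\<bar>Re u\<bar> \<le> \<sigma>"
    have "norm (Gamma_pair p u) \<le> (C * exp (- \<theta> * \<bar>Im (p + u)\<bar>)) * (C * exp (- \<theta> * \<bar>Im (p - u)\<bar>))"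
      unfolding Gamma_pair_def norm_mult using u C(1) by (intro mult_mono C(2)) auto
    also have "\<dots> = C * C * exp (- \<theta> * (\<bar>Im (p + u)\<bar> + \<bar>Im (p - u)\<bar>))"
      by (simp only: distrib_left exp_add mult_ac)
    also have "\<dots> \<le> C * C * exp (- \<theta> * (2 * \<bar>Im u\<bar>))"
      using assms C(1) by (intro mult_left_mono) (auto intro!: mult_left_mono)
    finally show "norm (Gamma_pair p u) \<le> C * C * exp (- 2 * \<theta> * \<bar>Im u\<bar>)"
      by (simp add: mult_ac)
  qed
qed

text \<open>The rate 9 is three pairs times two Gamma factors times 3/2, a rational number below pi
  / 2. It has to exceed 2 pi, the growth rate of the sine and the hyperbolic sine that multiply this
  product later.\<close>

lemma Gamma_pair_prod_decay:
  assumes "\<sigma> < Re a" "\<sigma> < Re b" "\<sigma> < Re d"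
  obtains C where "C > 0"
    "\<And>u. \<bar>Re u\<bar> \<le> \<sigma> \<Longrightarrow>
       norm (Gamma_pair a u * Gamma_pair b u * Gamma_pair d u) \<le> C * exp (- 9 * \<bar>Im u\<bar>)"
proof -
  have \<theta>: "0 \<le> (3/2::real)" "3/2 < pi / 2" using pi_gt3 by auto
  obtain A where A: "A > 0"
    "\<And>u. \<bar>Re u\<bar> \<le> \<sigma> \<Longrightarrow> norm (Gamma_pair a u) \<le> A * exp (- 2 * (3/2) * \<bar>Im u\<bar>)"
    using Gamma_pair_decay[OF \<theta> assms(1)] by metis
  obtain B where B: "B > 0"
    "\<And>u. \<bar>Re u\<bar> \<le> \<sigma> \<Longrightarrow> norm (Gamma_pair b u) \<le> B * exp (- 2 * (3/2) * \<bar>Im u\<bar>)"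
    using Gamma_pair_decay[OF \<theta> assms(2)] by metis
  obtain D where D: "D > 0"
    "\<And>u. \<bar>Re u\<bar> \<le> \<sigma> \<Longrightarrow> norm (Gamma_pair d u) \<le> D * exp (- 2 * (3/2) * \<bar>Im u\<bar>)"
    using Gamma_pair_decay[OF \<theta> assms(3)] by metis
  show ?thesis
  proof
    show "A * B * D > 0" using A B D by simp
    fix u assume u: "\<bar>Re u\<bar> \<le> \<sigma>"
    have "norm (Gamma_pair a u * Gamma_pair b u * Gamma_pair d u) \<le>
      (A * exp (- 2 * (3/2) * \<bar>Im u\<bar>)) * (B * exp (- 2 * (3/2) * \<bar>Im u\<bar>)) *
      (D * exp (- 2 * (3/2) * \<bar>Im u\<bar>))"
      unfolding norm_mult using u A(1) B(1) D(1)
      by (intro mult_mono A(2) B(2) D(2) mult_nonneg_nonneg) auto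
    also have "\<dots> = A * B * D * exp (- 2 * (3/2) * \<bar>Im u\<bar> + - 2 * (3/2) * \<bar>Im u\<bar> + - 2 * (3/2) * \<bar>Im u\<bar>)"
      by (simp only: exp_add mult_ac)
    finally show "norm (Gamma_pair a u * Gamma_pair b u * Gamma_pair d u) \<le> A * B * D * exp (- 9 * \<bar>Im u\<bar>)"
      by simp
  qed
qed

lemma norm_sin_le_exp: "norm (sin z) \<le> exp \<bar>Im z\<bar>"
proof -
  have "norm (exp (\<i> * z) - exp (- (\<i> * z))) \<le> norm (exp (\<i> * z)) + norm (exp (- (\<i> * z)))"
    by (rule norm_triangle_ineq4)
  also have "\<dots> \<le> exp \<bar>Im z\<bar> + exp \<bar>Im z\<bar>" by (intro add_mono) auto
  finally show ?thesis by (simp add: sin_exp_eq norm_divide norm_mult)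
qed

text \<open>By the reflection formula, the first factor is \<open>1 / (\<Gamma>(2ix) \<Gamma>(-2ix))\<close>.\<close>
definition weight :: "complex \<Rightarrow> complex \<Rightarrow> complex \<Rightarrow> real \<Rightarrow> complex" where
  "weight a b d x = of_real (2 * x * sinh (2 * pi * x) / pi) *
     (Gamma_pair a (\<i> * of_real x) * Gamma_pair b (\<i> * of_real x) * Gamma_pair d (\<i> * of_real x))"

lemma weight_minus [simp]: "weight a b d (- x) = weight a b d x"
  by (simp add: weight_def)

lemma weight_swap12: "weight a b d = weight b a d"
  by (simp add: weight_def fun_eq_iff mult_ac)

lemma weight_plus_1:
  "Re a > 0 \<Longrightarrow> weight (a + 1) b d x = (a\<^sup>2 + of_real (x\<^sup>2)) * weight a b d x"
  by (simp add: weight_def Gamma_pair_plus_1 power_mult_distrib)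

lemma continuous_on_Gamma_pair_vertical [continuous_intros]:
  "Re p > 0 \<Longrightarrow> continuous_on X (\<lambda>x. Gamma_pair p (\<i> * complex_of_real x))"
  by (rule continuous_on_compose2[OF holomorphic_on_imp_continuous_on[OF holomorphic_on_Gamma_pair]])
    (auto intro!: continuous_intros)

lemma continuous_on_weight:
  "Re a > 0 \<Longrightarrow> Re b > 0 \<Longrightarrow> Re d > 0 \<Longrightarrow> continuous_on X (weight a b d)"
  unfolding weight_def[abs_def] sinh_field_def by (intro continuous_intros) auto

text \<open>The rate 1/2 is 9 - 8 - 1/2: the 8 dominates the growth rate 2 pi of the hyperbolic
  sine, and the second 1/2 pays for the factor |x|.\<close>

lemma weight_decay:
  assumes "Re a > 0" "Re b > 0" "Re d > 0"
  obtains C where "C > 0" "\<And>x. norm (weight a b d x) \<le> C * exp (- (1 / 2) * \<bar>x\<bar>)"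
proof -
  obtain C where C: "C > 0" "\<And>u. \<bar>Re u\<bar> \<le> 0 \<Longrightarrow>
       norm (Gamma_pair a u * Gamma_pair b u * Gamma_pair d u) \<le> C * exp (- 9 * \<bar>Im u\<bar>)"
    using Gamma_pair_prod_decay[of 0 a b d] assms by auto
  show ?thesis
  proof
    show "2 * C > 0" using C by simp
    fix x :: real
    have sinh: "\<bar>sinh (2 * pi * x)\<bar> \<le> exp (2 * pi * \<bar>x\<bar>)"
    proof -
      have "\<bar>exp (2 * pi * x) - exp (- (2 * pi * x))\<bar> \<le> exp (2 * pi * \<bar>x\<bar>) + exp (2 * pi * \<bar>x\<bar>)"
        by (rule order.trans[OF abs_triangle_ineq4]) (auto intro!: add_mono simp: abs_if mult_nonneg_nonpos)
      then show ?thesis by (simp add: sinh_field_def)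
    qed
    have lin: "\<bar>x\<bar> \<le> 2 * exp (1 / 2 * \<bar>x\<bar>)"
      using exp_ge_add_one_self[of "1 / 2 * \<bar>x\<bar>"] by linarith
    have "\<bar>2 * x * sinh (2 * pi * x) / pi\<bar> = 2 / pi * (\<bar>x\<bar> * \<bar>sinh (2 * pi * x)\<bar>)"
      by (simp add: abs_mult)
    also have "\<dots> \<le> 1 * ((2 * exp (1 / 2 * \<bar>x\<bar>)) * exp (2 * pi * \<bar>x\<bar>))"
      using pi_gt3 by (intro mult_mono lin sinh) auto
    also have "\<dots> = 2 * exp (1 / 2 * \<bar>x\<bar> + 2 * pi * \<bar>x\<bar>)" by (simp add: exp_add)
    also have "\<dots> \<le> 2 * exp (1 / 2 * \<bar>x\<bar> + 2 * 4 * \<bar>x\<bar>)"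
      using pi_less_4 by (intro mult_left_mono) (auto intro!: mult_right_mono)
    finally have 1: "norm (complex_of_real (2 * x * sinh (2 * pi * x) / pi)) \<le> 2 * exp (17 / 2 * \<bar>x\<bar>)"
      unfolding norm_of_real by simp
    have "norm (weight a b d x) \<le> (2 * exp (17 / 2 * \<bar>x\<bar>)) * (C * exp (- 9 * \<bar>x\<bar>))"
      unfolding weight_def norm_mult[of "complex_of_real _"]
      using C(2)[of "\<i> * of_real x"] by (intro mult_mono 1) auto
    also have "\<dots> = 2 * C * exp (17 / 2 * \<bar>x\<bar> + - 9 * \<bar>x\<bar>)" by (simp only: exp_add mult_ac)
    finally show "norm (weight a b d x) \<le> 2 * C * exp (- (1 / 2) * \<bar>x\<bar>)" by simp
  qed
qed

lemma integrable_weight: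
  assumes "Re a > 0" "Re b > 0" "Re d > 0"
  shows "integrable lborel (weight a b d)"
proof -
  obtain C where "\<And>x. norm (weight a b d x) \<le> C * exp (- (1 / 2) * \<bar>x\<bar>)"
    using weight_decay[OF assms] by metis
  then show ?thesis
    using assms by (intro integrable_exp_decay[of "1/2"] continuous_on_weight) auto
qed

section \<open>The recurrence of the total mass under unit shifts of the parameters\<close>

definition mass :: "complex \<Rightarrow> complex \<Rightarrow> complex \<Rightarrow> complex" where
  "mass a b d = (LBINT x. weight a b d x)"

lemma mass_swap12: "mass a b d = mass b a d"
  unfolding mass_def by (simp only: weight_swap12[of a])

text \<open>
  The function \<open>h\<close> below is odd. On the line \<open>Re u = 1/2\<close> the symmetrization of \<open>h\<close> is a multiple of
  \<open>weight a b d t * (ab + ad + bd - t\<^sup>2)\<close>, and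
  \<open>a\<^sup>2 + t\<^sup>2 = (a + b)(a + d) - (ab + ad + bd - t\<^sup>2)\<close>.
\<close>
lemma mass_plus_1:
  assumes a: "Re a > 0" and b: "Re b > 0" and d: "Re d > 0"
  shows "mass (a + 1) b d = (a + b) * (a + d) * mass a b d"
proof -
  \<comment> \<open>The half shift is made for the line u = 1/2 + it: there p + 1/2 + u = p + it + 1
    and p + 1/2 - u = p - it, so each pair becomes (p + it) times the unshifted pair at it, and the
    sine becomes -i sinh(2 pi t).\<close>
  define h where "h u = Gamma_pair (a + 1 / 2) u * Gamma_pair (b + 1 / 2) u * Gamma_pair (d + 1 / 2) u *
     sin (2 * of_real pi * u)" for u
  define H where "H t = h (Complex (1 / 2) t)" for t
  define r where "r = Min {Re a, Re b, Re d} + 1 / 2"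
  have r: "1 / 2 < r" "r \<le> Re a + 1 / 2" "r \<le> Re b + 1 / 2" "r \<le> Re d + 1 / 2"
    using assms by (auto simp: r_def)
  obtain C where C: "C > 0" "\<And>u. \<bar>Re u\<bar> \<le> 1 / 2 \<Longrightarrow>
       norm (Gamma_pair (a + 1 / 2) u * Gamma_pair (b + 1 / 2) u * Gamma_pair (d + 1 / 2) u)
         \<le> C * exp (- 9 * \<bar>Im u\<bar>)"
    using Gamma_pair_prod_decay[of "1 / 2" "a + 1 / 2" "b + 1 / 2" "d + 1 / 2"] assms by auto
  have H: "integrable lborel H" "(LBINT t. H t) = 0"
    unfolding H_def
  proof (rule_tac [!] integral_vertical_odd_eq_0[where r = r and \<delta> = 1 and C = C and h = h])
    have "Gamma_pair (p + 1 / 2) holomorphic_on {z. \<bar>Re z\<bar> < r}" if "r \<le> Re p + 1 / 2" for p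
      by (rule holomorphic_on_subset[OF holomorphic_on_Gamma_pair]) (use that in auto)
    note hol = this[OF r(2)] this[OF r(3)] this[OF r(4)]
    show "h holomorphic_on {z. \<bar>Re z\<bar> < r}"
      unfolding h_def[abs_def] by (intro holomorphic_intros hol)
    then show "h holomorphic_on {z. \<bar>Re z\<bar> < r}" .
    show odd: "h (- z) = - h z" for z by (simp add: h_def)
    then show "h (- z) = - h z" for z .
    show decay: "norm (h z) \<le> C * exp (- 1 * \<bar>Im z\<bar>)" if "\<bar>Re z\<bar> \<le> 1 / 2" for z
    proof -
      have "norm (h z) \<le> (C * exp (- 9 * \<bar>Im z\<bar>)) * exp \<bar>Im (2 * of_real pi * z)\<bar>"
        unfolding h_def norm_mult[of _ "sin _"] using that C(1)
        by (intro mult_mono C(2) norm_sin_le_exp) auto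
      also have "\<bar>Im (2 * of_real pi * z)\<bar> = 2 * pi * \<bar>Im z\<bar>" by (simp add: abs_mult)
      also have "C * exp (- 9 * \<bar>Im z\<bar>) * exp (2 * pi * \<bar>Im z\<bar>) = C * exp (- 9 * \<bar>Im z\<bar> + 2 * pi * \<bar>Im z\<bar>)"
        by (simp only: exp_add mult_ac)
      also have "\<dots> \<le> C * exp (- 9 * \<bar>Im z\<bar> + 2 * 4 * \<bar>Im z\<bar>)"
        using pi_less_4 C(1) by (intro mult_left_mono) (auto intro!: mult_right_mono)
      finally show ?thesis by simp
    qed
    then show "norm (h z) \<le> C * exp (- 1 * \<bar>Im z\<bar>)" if "\<bar>Re z\<bar> \<le> 1 / 2" for z using that .
  qed (use r in auto)
  have H_eq: "H t = - \<i> * of_real (sinh (2 * pi * t)) *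
     ((a + \<i> * of_real t) * (b + \<i> * of_real t) * (d + \<i> * of_real t)) *
     (Gamma_pair a (\<i> * of_real t) * Gamma_pair b (\<i> * of_real t) * Gamma_pair d (\<i> * of_real t))" for t
  proof -
    have G: "Gamma_pair (p + 1 / 2) (Complex (1 / 2) t) = (p + \<i> * of_real t) * Gamma_pair p (\<i> * of_real t)"
      if "Re p > 0" for p
    proof -
      have "p + 1 / 2 + Complex (1 / 2) t = p + \<i> * of_real t + 1"
        "p + 1 / 2 - Complex (1 / 2) t = p - \<i> * of_real t"
        by (auto simp: complex_eq_iff)
      moreover have "Gamma (p + \<i> * of_real t + 1) = (p + \<i> * of_real t) * Gamma (p + \<i> * of_real t)"
        using that by (intro Gamma_plus1 nonpos_Ints_Re_pos) auto
      ultimately show ?thesis by (simp only: Gamma_pair_def mult.assoc)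
    qed
    have "2 * of_real pi * Complex (1 / 2) t = of_real pi + \<i> * of_real (2 * pi * t)"
      by (simp add: complex_eq_iff)
    then have "sin (2 * of_real pi * Complex (1 / 2) t) = - sin (\<i> * of_real (2 * pi * t))"
      by (simp add: sin_add)
    also have "\<dots> = - \<i> * of_real (sinh (2 * pi * t))"
    proof -
      have "(of_real (sinh (2 * pi * t)) :: complex) = - \<i> * sin (\<i> * of_real (2 * pi * t))"
        using sinh_real[of "2 * pi * t"] by (simp only: sinh_field_def exp_minus)
      then have "- \<i> * of_real (sinh (2 * pi * t)) = - \<i> * (- \<i> * sin (\<i> * of_real (2 * pi * t)))"
        by (rule arg_cong)
      also have "\<dots> = - sin (\<i> * of_real (2 * pi * t))"
        by (simp add: complex_eq_iff)
      finally show ?thesis ..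
    qed
    finally have S: "sin (2 * of_real pi * Complex (1 / 2) t) = - \<i> * of_real (sinh (2 * pi * t))" .
    show ?thesis
      unfolding H_def h_def S G[OF a] G[OF b] G[OF d] by (simp only: mult_ac)
  qed
  define q where "q t = weight a b d t * (a * b + a * d + b * d - of_real (t\<^sup>2))" for t
  have q_eq: "q t = (H t + H (- t)) / of_real pi" for t
  proof -
    define P where "P = Gamma_pair a (\<i> * of_real t) * Gamma_pair b (\<i> * of_real t) * Gamma_pair d (\<i> * of_real t)"
    define s where "s = complex_of_real (sinh (2 * pi * t))"
    define T where "T = complex_of_real t"
    have H1: "H t = - \<i> * s * ((a + \<i> * T) * (b + \<i> * T) * (d + \<i> * T)) * P"
      by (simp only: H_eq s_def T_def P_def)
    have H2: "H (- t) = \<i> * s * ((a - \<i> * T) * (b - \<i> * T) * (d - \<i> * T)) * P"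
      by (simp add: H_eq s_def T_def P_def)
    \<comment> \<open>Adding the values at t and -t keeps only the part of the cubic that is odd in
      J = it. Its factor J supplies the factor t of the weight.\<close>
    have "(a + J) * (b + J) * (d + J) - (a - J) * (b - J) * (d - J) = 2 * J * (a * b + a * d + b * d + J\<^sup>2)" for J
      by (simp add: algebra_simps power2_eq_square)
    from this[of "\<i> * T"]
    have "(a + \<i> * T) * (b + \<i> * T) * (d + \<i> * T) - (a - \<i> * T) * (b - \<i> * T) * (d - \<i> * T) =
      2 * \<i> * T * (a * b + a * d + b * d - T\<^sup>2)"
      by (simp add: power_mult_distrib mult.assoc)
    then have "- \<i> * s * P * ((a + \<i> * T) * (b + \<i> * T) * (d + \<i> * T) - (a - \<i> * T) * (b - \<i> * T) * (d - \<i> * T)) =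
      - \<i> * s * P * (2 * \<i> * T * (a * b + a * d + b * d - T\<^sup>2))"
      by (rule arg_cong)
    also have "\<dots> = (- \<i> * \<i>) * (2 * T * s * P * (a * b + a * d + b * d - T\<^sup>2))"
      by (simp only: mult_ac mult_minus_left mult_minus_right)
    also have "\<dots> = 2 * T * s * P * (a * b + a * d + b * d - T\<^sup>2)"
      by simp
    finally have HP: "- \<i> * s * P * ((a + \<i> * T) * (b + \<i> * T) * (d + \<i> * T) - (a - \<i> * T) * (b - \<i> * T) * (d - \<i> * T)) =
      2 * T * s * P * (a * b + a * d + b * d - T\<^sup>2)" .
    have "- \<i> * s * A * P + \<i> * s * B * P = - \<i> * s * P * (A - B)" for A B
      by (simp add: algebra_simps)
    then have "H t + H (- t) = 2 * T * s * P * (a * b + a * d + b * d - T\<^sup>2)"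
      unfolding H1 H2 HP[symmetric] .
    moreover have "q t = 2 * T * s / of_real pi * P * (a * b + a * d + b * d - T\<^sup>2)"
      by (simp add: q_def weight_def P_def s_def T_def)
    ultimately show ?thesis by simp
  qed
  have H': "integrable lborel (\<lambda>t. H (- t))" "(LBINT t. H (- t)) = 0"
    using lborel_integrable_real_affine[OF H(1), of "-1" 0] lborel_integral_real_affine[of "-1" H 0] H(2)
    by auto
  have q: "integrable lborel q" "(LBINT t. q t) = 0"
    unfolding q_eq[abs_def] using H H' by auto
  have "weight (a + 1) b d t = (a + b) * (a + d) * weight a b d t - q t" for t
    unfolding weight_plus_1[OF a] q_def by (simp add: algebra_simps power2_eq_square)
  then show ?thesis
    using q integrable_weight[OF assms] by (simp add: mass_def)
qed

lemma mass_pochhammer: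
  assumes "Re a > 0" "Re b > 0" "Re d > 0"
  shows "mass (a + of_nat n) b d = pochhammer (a + b) n * pochhammer (a + d) n * mass a b d"
proof (induction n)
  case (Suc n)
  have "mass (a + of_nat (Suc n)) b d = mass (a + of_nat n + 1) b d" by (simp add: add_ac)
  also have "\<dots> = (a + of_nat n + b) * (a + of_nat n + d) * mass (a + of_nat n) b d"
    using assms by (intro mass_plus_1) auto
  finally show ?case by (simp add: Suc pochhammer_Suc algebra_simps)
qed simp

lemma mass_pochhammer2:
  assumes "Re a > 0" "Re b > 0" "Re d > 0"
  shows "mass (a + of_nat m) (b + of_nat n) d =
    pochhammer (a + b) (m + n) * pochhammer (a + d) m * pochhammer (b + d) n * mass a b d"
proof -
  have "mass (a + of_nat m) (b + of_nat n) d = mass (b + of_nat n) (a + of_nat m) d"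
    by (rule mass_swap12)
  also have "\<dots> = pochhammer (b + (a + of_nat m)) n * pochhammer (b + d) n * mass b (a + of_nat m) d"
    using assms by (intro mass_pochhammer) auto
  also have "mass b (a + of_nat m) d = mass (a + of_nat m) b d"
    by (rule mass_swap12)
  also have "\<dots> = pochhammer (a + b) m * pochhammer (a + d) m * mass a b d"
    using assms by (rule mass_pochhammer)
  finally show ?thesis by (simp add: pochhammer_product'[of "a + b" m n] algebra_simps)
qed

text \<open>The Pochhammer symbols produced by the shifted mass are exactly those produced by the
  three shifted Gamma values, and they do not vanish.\<close>

lemma mass_eq_mass_shift:
  assumes "Re a > 0" "Re b > 0" "Re d > 0"
  shows "mass a b d / (Gamma (a + b) * Gamma (a + d) * Gamma (b + d)) =
    mass (a + of_nat m) (b + of_nat n) d /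
      (Gamma (a + of_nat m + (b + of_nat n)) * Gamma (a + of_nat m + d) * Gamma (b + of_nat n + d))"
proof -
  have G: "Gamma (z + of_nat k) = pochhammer z k * Gamma z \<and> pochhammer z k \<noteq> 0" if "Re z > 0" for z :: complex and k
    using that pochhammer_Gamma[of z k] Gamma_neq_0_Re_pos[of z] Gamma_neq_0_Re_pos[of "z + of_nat k"]
      nonpos_Ints_Re_pos by simp
  have eq: "a + of_nat m + (b + of_nat n) = a + b + of_nat (m + n)"
    "a + of_nat m + d = a + d + of_nat m" "b + of_nat n + d = b + d + of_nat n"
    by simp_all
  have pos: "Re (a + b) > 0" "Re (a + d) > 0" "Re (b + d) > 0" using assms by auto
  have "M / (x * y * z) = p * q * r * M / ((p * x) * (q * y) * (r * z))"
    if "p \<noteq> 0" "q \<noteq> 0" "r \<noteq> 0" for M x y z p q r :: complex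
    using that by (simp add: divide_simps)
  then show ?thesis
    unfolding eq mass_pochhammer2[OF assms] pos[THEN G, THEN conjunct1]
    using pos[THEN G, THEN conjunct2] by blast
qed

text \<open>Built from moduli, this is real and nonnegative, so that integrals can be compared by
  inequalities. It agrees with \<open>weight\<close> when the parameters are closed under
  conjugation.\<close>

definition real_weight :: "complex \<Rightarrow> complex \<Rightarrow> complex \<Rightarrow> real \<Rightarrow> real" where
  "real_weight a b d x = 2 * x * sinh (2 * pi * x) / pi *
     ((norm (Gamma (a + \<i> * of_real x)))\<^sup>2 * (norm (Gamma (b + \<i> * of_real x)))\<^sup>2 *
      (norm (Gamma (d + \<i> * of_real x)))\<^sup>2)"

lemma norm_Gamma_square: "of_real ((norm (Gamma z))\<^sup>2) = Gamma z * Gamma (cnj z)"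
  by (simp only: complex_norm_square cnj_Gamma)

lemma Gamma_pair_of_real:
  "Gamma_pair (of_real p) (\<i> * of_real x) = of_real ((norm (Gamma (of_real p + \<i> * of_real x)))\<^sup>2)"
  unfolding norm_Gamma_square by (simp add: Gamma_pair_def)

text \<open>For non-real a a single pair need not be a squared modulus. In the product of both pairs
  the four factors regroup, because the conjugate of a + ix is cnj a - ix.\<close>

lemma Gamma_pair_cnj:
  "Gamma_pair a (\<i> * of_real x) * Gamma_pair (cnj a) (\<i> * of_real x) =
    of_real ((norm (Gamma (a + \<i> * of_real x)))\<^sup>2 * (norm (Gamma (cnj a + \<i> * of_real x)))\<^sup>2)"
  unfolding of_real_mult norm_Gamma_square by (simp add: Gamma_pair_def)

text \<open>Invariance of the multiset of parameters under conjugation, split into the cases that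
  the later arguments distinguish. The cases overlap when all parameters are real.\<close>

definition conj_closed :: "complex \<Rightarrow> complex \<Rightarrow> complex \<Rightarrow> bool" where
  "conj_closed a b d \<longleftrightarrow> (a \<in> \<real> \<and> b \<in> \<real> \<and> d \<in> \<real>) \<or>
     (a = cnj b \<and> d \<in> \<real>) \<or> (a = cnj d \<and> b \<in> \<real>) \<or> (b = cnj d \<and> a \<in> \<real>)"

lemma weight_eq_real_weight:
  assumes "conj_closed a b d"
  shows "weight a b d x = of_real (real_weight a b d x)"
proof -
  let ?N = "\<lambda>p. (norm (Gamma (p + \<i> * of_real x)))\<^sup>2"
  have real: "Gamma_pair p (\<i> * of_real x) = of_real (?N p)" if "p \<in> \<real>" for p
    using that Gamma_pair_of_real by (auto elim!: Reals_cases)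
  have pair: "Gamma_pair p (\<i> * of_real x) * Gamma_pair q (\<i> * of_real x) = of_real (?N p * ?N q)"
    if "p = cnj q" for p q
    using Gamma_pair_cnj[of p x] that by simp
  have "Gamma_pair a (\<i> * of_real x) * Gamma_pair b (\<i> * of_real x) * Gamma_pair d (\<i> * of_real x) =
    of_real (?N a * ?N b * ?N d)"
    using assms unfolding conj_closed_def
  proof (elim disjE conjE)
    assume "a = cnj b" "d \<in> \<real>"
    show ?thesis
      unfolding pair[OF \<open>a = cnj b\<close>] real[OF \<open>d \<in> \<real>\<close>] by simp
  next
    assume "a = cnj d" "b \<in> \<real>"
    have "Gamma_pair a (\<i> * of_real x) * Gamma_pair b (\<i> * of_real x) * Gamma_pair d (\<i> * of_real x) =
      (Gamma_pair a (\<i> * of_real x) * Gamma_pair d (\<i> * of_real x)) * Gamma_pair b (\<i> * of_real x)"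
      by (simp add: mult_ac)
    also have "\<dots> = of_real (?N a * ?N d) * of_real (?N b)"
      unfolding pair[OF \<open>a = cnj d\<close>] real[OF \<open>b \<in> \<real>\<close>] ..
    also have "\<dots> = of_real (?N a * ?N b * ?N d)"
      by (simp add: mult_ac)
    finally show ?thesis .
  next
    assume "b = cnj d" "a \<in> \<real>"
    show ?thesis
      unfolding mult.assoc pair[OF \<open>b = cnj d\<close>] real[OF \<open>a \<in> \<real>\<close>] by simp
  qed (simp add: real)
  then show ?thesis by (simp only: weight_def real_weight_def of_real_mult)
qed

lemma integral_real_weight:
  assumes "Re a > 0" "Re b > 0" "Re d > 0" "conj_closed a b d"
  shows "integrable lborel (real_weight a b d)"
    and "mass a b d = of_real (LBINT x. real_weight a b d x)"
proof -
  have eq: "weight a b d = (\<lambda>x. of_real (real_weight a b d x))"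
    using assms weight_eq_real_weight by blast
  show "integrable lborel (real_weight a b d)"
    using integrable_Re[OF integrable_weight[OF assms(1-3)]] by (simp add: eq)
  then show "mass a b d = of_real (LBINT x. real_weight a b d x)"
    by (simp add: mass_def eq)
qed

section \<open>Positivity, and the integral that fixes the constant\<close>

lemma x_sinh_nonneg: "0 \<le> 2 * x * sinh (2 * pi * x) / pi"
proof -
  have "0 \<le> x * sinh (2 * pi * x)"
  proof (cases "x \<ge> 0")
    case True
    then show ?thesis by (intro mult_nonneg_nonneg) (simp_all add: sinh_real_nonneg_iff)
  next
    case False
    then have "pi * x \<le> 0" by (intro mult_nonneg_nonpos) auto
    then show ?thesis using False
      by (intro mult_nonpos_nonpos) (simp_all add: sinh_real_nonpos_iff)
  qed
  then show ?thesis by simp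
qed

text \<open>Integration by parts: sinh(pi x) / cosh(pi x)^2 has the primitive -1 / (pi cosh(pi x)),
  and the remaining integrand 1 / (pi cosh(pi x)) has the primitive (2 / pi^2) arctan(e^(pi x)).
  Only the arctangent contributes in the limit.\<close>

lemma integral_x_sinh_over_cosh_squared:
  "(LBINT x. x * sinh (pi * x) / (cosh (pi * x))\<^sup>2) = 1 / pi"
proof -
  define f where "f x = x * sinh (pi * x) / (cosh (pi * x))\<^sup>2" for x :: real
  define F where "F x = - x / (pi * cosh (pi * x)) + 2 / pi\<^sup>2 * arctan (exp (pi * x))" for x :: real
  have "(F has_real_derivative f x) (at x)" for x
  proof -
    define e where "e = exp (pi * x)"
    have e: "e > 0" by (simp add: e_def)
    have "((\<lambda>x. - x / (pi * cosh (pi * x))) has_real_derivative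
       - 1 / (pi * cosh (pi * x)) + x * sinh (pi * x) / (cosh (pi * x))\<^sup>2) (at x)"
      by (auto intro!: derivative_eq_intros simp: field_simps power2_eq_square)
    moreover have "((\<lambda>x. 2 / pi\<^sup>2 * arctan (exp (pi * x))) has_real_derivative
         2 / pi\<^sup>2 * (inverse (1 + e\<^sup>2) * (e * pi))) (at x)"
      unfolding e_def by (intro DERIV_cmult) (auto intro!: derivative_eq_intros)
    ultimately have "(F has_real_derivative
       (- 1 / (pi * cosh (pi * x)) + x * sinh (pi * x) / (cosh (pi * x))\<^sup>2 +
         2 / pi\<^sup>2 * (inverse (1 + e\<^sup>2) * (e * pi)))) (at x)"
      unfolding F_def[abs_def] by (rule DERIV_add)
    moreover have "2 / pi\<^sup>2 * (inverse (1 + e\<^sup>2) * (e * pi)) = 1 / (pi * cosh (pi * x))"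
    proof -
      have "cosh (pi * x) = (1 + e\<^sup>2) / (2 * e)"
        using e by (simp add: cosh_field_def e_def[symmetric] exp_minus divide_simps power2_eq_square)
      moreover have "1 + e\<^sup>2 > 0" by (intro add_pos_nonneg) auto
      ultimately show ?thesis using e by (simp add: divide_simps power2_eq_square mult_ac)
    qed
    ultimately show ?thesis by (simp add: f_def)
  qed
  moreover have "isCont f x" for x
    unfolding f_def[abs_def] by (intro continuous_intros) auto
  moreover have nonneg: "0 \<le> f x" for x
  proof -
    have "0 \<le> x * sinh (pi * x)"
      using x_sinh_nonneg[of "x / 2"] pi_gt_zero by (auto simp: zero_le_divide_iff)
    then show ?thesis by (simp add: f_def)
  qed
  moreover have "(F \<longlongrightarrow> 0) at_bot"
  proof -
    have "((\<lambda>x. - x / (pi * cosh (pi * x))) \<longlongrightarrow> 0) at_bot"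
      unfolding cosh_field_def by real_asymp
    moreover have "((\<lambda>x. 2 / pi\<^sup>2 * arctan (exp (pi * x))) \<longlongrightarrow> 2 / pi\<^sup>2 * arctan 0) at_bot"
      by (intro tendsto_intros filterlim_compose[OF exp_at_bot]
          filterlim_tendsto_pos_mult_at_bot[OF tendsto_const] filterlim_ident) auto
    ultimately have "(F \<longlongrightarrow> 0 + 2 / pi\<^sup>2 * arctan 0) at_bot"
      unfolding F_def[abs_def] by (rule tendsto_add)
    then show ?thesis by simp
  qed
  moreover have "(F \<longlongrightarrow> 1 / pi) at_top"
  proof -
    have "((\<lambda>x. - x / (pi * cosh (pi * x))) \<longlongrightarrow> 0) at_top"
      unfolding cosh_field_def by real_asymp
    moreover have "((\<lambda>x. 2 / pi\<^sup>2 * arctan (exp (pi * x))) \<longlongrightarrow> 2 / pi\<^sup>2 * (pi / 2)) at_top"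
      by (intro tendsto_intros filterlim_compose[OF tendsto_arctan_at_top] filterlim_compose[OF exp_at_top]
          filterlim_tendsto_pos_mult_at_top[OF tendsto_const] filterlim_ident) auto
    ultimately have "(F \<longlongrightarrow> 0 + 2 / pi\<^sup>2 * (pi / 2)) at_top"
      unfolding F_def[abs_def] by (rule tendsto_add)
    then show ?thesis by (simp add: power2_eq_square)
  qed
  ultimately have "(LBINT x=-\<infinity>..\<infinity>. f x) = 1 / pi - 0"
    by (intro interval_integral_FTC_nonneg(2)[where F = F]) (auto simp: ereal_tendsto_simps)
  then show ?thesis
    by (simp add: interval_lebesgue_integral_def set_lebesgue_integral_def f_def)
qed

text \<open>At 1/2 each squared Gamma modulus is pi / cosh(pi x), and doubling the argument of sinh
  cancels one of the three cosh factors. All sums of two parameters are 1, so the Gamma values of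
  the mass formula are 1 and the integral is the constant itself.\<close>

lemma mass_half: "mass (1 / 2) (1 / 2) (1 / 2) = 4 * of_real pi"
proof -
  define f where "f x = x * sinh (pi * x) / (cosh (pi * x))\<^sup>2" for x :: real
  have half: "real_weight (1 / 2) (1 / 2) (1 / 2) x = 4 * pi\<^sup>2 * f x" for x
  proof -
    define c where "c = cosh (pi * x)"
    have c: "c \<noteq> 0" by (simp add: c_def)
    have "1 / 2 + \<i> * complex_of_real x = Complex (1 / 2) x" by (simp add: complex_eq_iff)
    then have N: "(norm (Gamma (1 / 2 + \<i> * complex_of_real x)))\<^sup>2 = pi / c"
      using norm_Gamma_half_vertical[of x] by (simp only: c_def)
    have S: "sinh (2 * pi * x) = 2 * sinh (pi * x) * c"
      using sinh_double[of "pi * x"] unfolding c_def mult.assoc .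
    show ?thesis
      unfolding real_weight_def N S f_def c_def[symmetric]
      using c by (simp add: divide_simps power2_eq_square)
  qed
  have conj: "conj_closed (1 / 2) (1 / 2) (1 / 2)"
    by (simp add: conj_closed_def)
  have "(LBINT x. real_weight (1 / 2) (1 / 2) (1 / 2) x) = 4 * pi\<^sup>2 * (1 / pi)"
    unfolding half f_def integral_mult_right_zero integral_x_sinh_over_cosh_squared ..
  then show ?thesis
    using integral_real_weight(2)[OF _ _ _ conj] by (simp add: power2_eq_square)
qed

text \<open>The limit formula for Gamma says that |Gamma(z + n)| is asymptotic to (n - 1)! n^(Re z),
  and \<open>g z n\<close> is the relative error. With four factors on each side and equal sums of
  real parts, everything except the errors cancels.\<close>

lemma norm_Gamma_ratio_tendsto_1:
  fixes p1 p2 p3 p4 q1 q2 q3 q4 :: complex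
  assumes pos: "Re p1 > 0" "Re p2 > 0" "Re p3 > 0" "Re p4 > 0"
      "Re q1 > 0" "Re q2 > 0" "Re q3 > 0" "Re q4 > 0"
    and Re_eq: "Re p1 + Re p2 + Re p3 + Re p4 = Re q1 + Re q2 + Re q3 + Re q4"
  shows "(\<lambda>n. (norm (Gamma (p1 + of_nat n)) * norm (Gamma (p2 + of_nat n)) *
      norm (Gamma (p3 + of_nat n)) * norm (Gamma (p4 + of_nat n))) /
     (norm (Gamma (q1 + of_nat n)) * norm (Gamma (q2 + of_nat n)) *
      norm (Gamma (q3 + of_nat n)) * norm (Gamma (q4 + of_nat n)))) \<longlonglongrightarrow> 1"
proof -
  define g where "g z n = norm (Gamma z) / norm (Gamma_series' z n)" for z :: complex and n
  have g: "g z \<longlonglongrightarrow> 1" if "Re z > 0" for z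
  proof -
    have "g z \<longlonglongrightarrow> norm (Gamma z) / norm (Gamma z)"
      unfolding g_def[abs_def] using Gamma_neq_0_Re_pos[OF that]
      by (intro tendsto_divide tendsto_const tendsto_norm Gamma_series'_LIMSEQ) auto
    then show ?thesis using Gamma_neq_0_Re_pos[OF that] by simp
  qed
  have G: "norm (Gamma (z + of_nat n)) = g z n * fact (n - 1) * exp (Re z * ln (real n))"
    if "Re z > 0" "n > 0" for z n
  proof -
    have "Gamma (z + of_nat n) = pochhammer z n * Gamma z"
      using pochhammer_Gamma[of z n] Gamma_neq_0_Re_pos[of z] nonpos_Ints_Re_pos that by simp
    moreover have "pochhammer z n \<noteq> 0"
      using that nonpos_Ints_Re_pos pochhammer_eq_0_imp_nonpos_Int by blast
    ultimately show ?thesis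
      using that by (simp add: g_def Gamma_series'_def norm_mult norm_divide)
  qed
  have lim: "(\<lambda>n. (g p1 n * g p2 n * g p3 n * g p4 n) / (g q1 n * g q2 n * g q3 n * g q4 n)) \<longlonglongrightarrow>
     (1 * 1 * 1 * 1) / (1 * 1 * 1 * 1)"
    by (rule tendsto_divide[OF tendsto_mult[OF tendsto_mult[OF tendsto_mult[OF
            pos(1)[THEN g] pos(2)[THEN g]] pos(3)[THEN g]] pos(4)[THEN g]]
          tendsto_mult[OF tendsto_mult[OF tendsto_mult[OF
            pos(5)[THEN g] pos(6)[THEN g]] pos(7)[THEN g]] pos(8)[THEN g]]]) simp
  have "\<forall>\<^sub>F n in sequentially. (g p1 n * g p2 n * g p3 n * g p4 n) / (g q1 n * g q2 n * g q3 n * g q4 n) =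
     (norm (Gamma (p1 + of_nat n)) * norm (Gamma (p2 + of_nat n)) *
      norm (Gamma (p3 + of_nat n)) * norm (Gamma (p4 + of_nat n))) /
     (norm (Gamma (q1 + of_nat n)) * norm (Gamma (q2 + of_nat n)) *
      norm (Gamma (q3 + of_nat n)) * norm (Gamma (q4 + of_nat n)))"
    using eventually_gt_at_top[of 0]
  proof eventually_elim
    case (elim n)
    define E where "E z = exp (Re z * ln (real n))" for z
    have E: "E p1 * E p2 * E p3 * E p4 = E q1 * E q2 * E q3 * E q4"
      unfolding E_def exp_add[symmetric] distrib_right[symmetric] Re_eq ..
    have nz: "fact (n - 1) ^ 4 * (E q1 * E q2 * E q3 * E q4) \<noteq> 0" by (simp add: E_def)
    have prod: "norm (Gamma (z1 + of_nat n)) * norm (Gamma (z2 + of_nat n)) *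
      norm (Gamma (z3 + of_nat n)) * norm (Gamma (z4 + of_nat n)) =
      g z1 n * g z2 n * g z3 n * g z4 n * (fact (n - 1) ^ 4 * (E z1 * E z2 * E z3 * E z4))"
      if z: "Re z1 > 0" "Re z2 > 0" "Re z3 > 0" "Re z4 > 0" for z1 z2 z3 z4
      unfolding z[THEN G, OF elim] E_def power4_eq_xxxx by (simp only: mult_ac)
    show ?case
      unfolding prod[OF pos(1-4)] prod[OF pos(5-8)] E
      by (rule mult_divide_mult_cancel_right[OF nz, symmetric])
  qed
  from Lim_transform_eventually[OF lim this] show ?thesis by simp
qed

section \<open>Reality of the normalized mass\<close>

lemma Gamma_of_real_eq_norm: "p > 0 \<Longrightarrow> Gamma (complex_of_real p) = of_real (norm (Gamma (complex_of_real p)))"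
  by (simp add: norm_Gamma_of_real Gamma_complex_of_real)

lemma Gamma_Reals_eq_norm:
  "p \<in> \<real> \<Longrightarrow> Re p > 0 \<Longrightarrow> Gamma p = of_real (norm (Gamma p))"
  by (auto elim!: Reals_cases intro: Gamma_of_real_eq_norm)

lemma Gamma_mult_Gamma_cnj: "Gamma z * Gamma (cnj z) = of_real (norm (Gamma z) * norm (Gamma (cnj z)))"
proof -
  have "norm (Gamma (cnj z)) = norm (Gamma z)" by (metis cnj_Gamma complex_mod_cnj)
  then show ?thesis using norm_Gamma_square[of z] by (simp add: power2_eq_square)
qed

text \<open>If p and q are conjugate and r is real, then p + r and q + r are conjugate and p + q is
  real and positive. Hence the product is positive and may be replaced by its modulus.\<close>

lemma Gamma_prod_conj_closed:
  assumes "Re a > 0" "Re b > 0" "Re d > 0" "conj_closed a b d"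
  shows "Gamma (a + b) * Gamma (a + d) * Gamma (b + d) =
    of_real (norm (Gamma (a + b)) * norm (Gamma (a + d)) * norm (Gamma (b + d)))"
proof -
  have pair: "Gamma (p + r) * Gamma (q + r) * Gamma (p + q) =
     of_real (norm (Gamma (p + r)) * norm (Gamma (q + r)) * norm (Gamma (p + q)))"
    if "p = cnj q" "r \<in> \<real>" "Re p > 0" "Re r > 0" for p q r
  proof -
    have "q + r = cnj (p + r)" using that by (auto elim!: Reals_cases)
    then have 1: "Gamma (p + r) * Gamma (q + r) = of_real (norm (Gamma (p + r)) * norm (Gamma (q + r)))"
      using Gamma_mult_Gamma_cnj[of "p + r"] by simp
    have "p + q = of_real (2 * Re p)" using that by (simp add: complex_eq_iff)
    then have "p + q \<in> \<real>" "Re (p + q) > 0" using that by auto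
    from Gamma_Reals_eq_norm[OF this] have 2: "Gamma (p + q) = of_real (norm (Gamma (p + q)))" .
    show ?thesis unfolding 1 by (subst 2) simp
  qed
  show ?thesis using assms(4) unfolding conj_closed_def
  proof (elim disjE conjE)
    assume "a \<in> \<real>" "b \<in> \<real>" "d \<in> \<real>"
    then have "Gamma (a + b) = of_real (norm (Gamma (a + b)))" "Gamma (a + d) = of_real (norm (Gamma (a + d)))"
      "Gamma (b + d) = of_real (norm (Gamma (b + d)))"
      using assms by (auto intro!: Gamma_Reals_eq_norm)
    then show ?thesis by simp
  next
    assume "a = cnj b" "d \<in> \<real>"
    from pair[OF this] assms show ?thesis by (simp add: mult_ac add.commute)
  next
    assume "a = cnj d" "b \<in> \<real>"
    from pair[OF this] assms show ?thesis by (simp add: mult_ac add.commute)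
  next
    assume "b = cnj d" "a \<in> \<real>"
    from pair[OF this] assms show ?thesis by (simp add: mult_ac add.commute)
  qed
qed

text \<open>This is the quotient of the overview without the constant, as a real number; the value
  to be established is therefore 4 pi.\<close>

definition mass_ratio :: "complex \<Rightarrow> complex \<Rightarrow> complex \<Rightarrow> real" where
  "mass_ratio a b d = (LBINT x. real_weight a b d x) /
     (norm (Gamma (a + b)) * norm (Gamma (a + d)) * norm (Gamma (b + d)))"

lemma mass_ratio_eq:
  assumes "Re a > 0" "Re b > 0" "Re d > 0" "conj_closed a b d"
  shows "of_real (mass_ratio a b d) = mass a b d / (Gamma (a + b) * Gamma (a + d) * Gamma (b + d))"
  unfolding Gamma_prod_conj_closed[OF assms] integral_real_weight(2)[OF assms] mass_ratio_def
  by simp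

lemma mass_eq_mass_ratio:
  assumes "Re a > 0" "Re b > 0" "Re d > 0" "conj_closed a b d"
  shows "mass a b d = of_real (mass_ratio a b d) * (Gamma (a + b) * Gamma (a + d) * Gamma (b + d))"
  using assms by (simp add: mass_ratio_eq Gamma_neq_0_Re_pos)

section \<open>Constancy of the normalized mass\<close>

lemma real_weight_swap12: "real_weight a b d = real_weight b a d"
  and real_weight_swap23: "real_weight a b d = real_weight a d b"
  by (simp_all add: real_weight_def fun_eq_iff)

lemma mass_ratio_swap12: "mass_ratio a b d = mass_ratio b a d"
  unfolding mass_ratio_def real_weight_swap12[of a b d] by (simp add: mult_ac add.commute)

lemma mass_ratio_swap23: "mass_ratio a b d = mass_ratio a d b"
  unfolding mass_ratio_def real_weight_swap23[of a b d] by (simp add: mult_ac add.commute)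

text \<open>Closure under conjugation is required of the shifted parameters too, since unequal
  shifts break a non-real pair. The uses shift one real parameter, or both members of a pair by the
  same amount.\<close>

lemma mass_ratio_shift:
  assumes "Re a > 0" "Re b > 0" "Re d > 0" "conj_closed a b d"
    "conj_closed (a + of_nat m) (b + of_nat n) d"
  shows "mass_ratio a b d = mass_ratio (a + of_nat m) (b + of_nat n) d"
proof -
  have "complex_of_real (mass_ratio a b d) = of_real (mass_ratio (a + of_nat m) (b + of_nat n) d)"
    using assms mass_eq_mass_shift[OF assms(1-3), of m n]
    by (simp only: mass_ratio_eq) (simp add: mass_ratio_eq)
  then show ?thesis by (simp only: of_real_eq_iff)
qed

lemma real_weight_mono:
  assumes "0 < s" "s \<le> t"
  shows "real_weight (of_real s) b d x * (norm (Gamma (complex_of_real t)))\<^sup>2 \<le>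
    real_weight (of_real t) b d x * (norm (Gamma (complex_of_real s)))\<^sup>2"
proof -
  define K where "K = 2 * x * sinh (2 * pi * x) / pi *
    ((norm (Gamma (b + \<i> * of_real x)))\<^sup>2 * (norm (Gamma (d + \<i> * of_real x)))\<^sup>2)"
  have K: "0 \<le> K" unfolding K_def by (intro mult_nonneg_nonneg x_sinh_nonneg) auto
  have eq: "real_weight (of_real p) b d x = K * (norm (Gamma (Complex p x)))\<^sup>2" for p
    by (simp add: real_weight_def K_def Complex_eq)
  have "(norm (Gamma (Complex s x)) * Gamma t)\<^sup>2 \<le> (norm (Gamma (Complex t x)) * Gamma s)\<^sup>2"
    using assms by (intro power_mono norm_Gamma_vertical_mono mult_nonneg_nonneg) auto
  from mult_left_mono[OF this K] show ?thesis
    using assms by (simp add: eq norm_Gamma_of_real power_mult_distrib mult.assoc)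
qed

text \<open>Integrating the pointwise comparison at s + n and t + n gives the inequality up to the
  factor \<open>c n\<close>. The two ratios do not depend on n, and \<open>c n\<close> tends to
  1.\<close>

lemma mass_ratio_mono_real:
  assumes "0 < s" "s \<le> t" "0 < p" "0 < q"
  shows "mass_ratio (of_real s) (of_real p) (of_real q) \<le> mass_ratio (of_real t) (of_real p) (of_real q)"
proof -
  define N where "N z n = norm (Gamma (z + of_nat n))" for z :: complex and n
  \<comment> \<open>The squares come from the comparison of the weights, the other factors from the
    normalizing denominators. The real parts sum to 2s + 2t + p + q above and below the bar, so the
    quotient tends to 1.\<close>
  define c where "c n = (N (of_real s) n * N (of_real s) n * N (of_real (t + p)) n * N (of_real (t + q)) n) /
    (N (of_real t) n * N (of_real t) n * N (of_real (s + p)) n * N (of_real (s + q)) n)" for n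
  have conj: "conj_closed (of_real u + of_nat n) (of_real p) (of_real q)" for u n
    by (simp add: conj_closed_def)
  have c: "c \<longlonglongrightarrow> 1"
    unfolding c_def[abs_def] N_def by (rule norm_Gamma_ratio_tendsto_1) (use assms in auto)
  have Npos: "N (of_real u) n > 0" if "u > 0" for u n
    unfolding N_def using that by (simp add: Gamma_neq_0_Re_pos)
  have "mass_ratio (of_real s) (of_real p) (of_real q) \<le> mass_ratio (of_real t) (of_real p) (of_real q) * c n" for n
  proof -
    define M where "M u = (LBINT x. real_weight (of_real u + of_nat n) (of_real p) (of_real q) x)" for u
    have int: "integrable lborel (real_weight (of_real u + of_nat n) (of_real p) (of_real q))" if "u > 0" for u
      using that assms by (intro integral_real_weight conj) auto
    have ratio: "mass_ratio (of_real u) (of_real p) (of_real q) =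
       M u / (N (of_real (u + p)) n * N (of_real (u + q)) n * norm (Gamma (complex_of_real (p + q))))"
      if "u > 0" for u
    proof -
      have "mass_ratio (of_real u) (of_real p) (of_real q) =
         mass_ratio (of_real u + of_nat n) (of_real p + of_nat 0) (of_real q)"
        using that assms conj[of u n] conj[of u 0] by (intro mass_ratio_shift) auto
      then show ?thesis by (simp add: mass_ratio_def M_def N_def add_ac)
    qed
    have "M s * (N (of_real t) n)\<^sup>2 \<le> M t * (N (of_real s) n)\<^sup>2"
    proof -
      have "(LBINT x. real_weight (of_real s + of_nat n) (of_real p) (of_real q) x * (N (of_real t) n)\<^sup>2) \<le>
        (LBINT x. real_weight (of_real t + of_nat n) (of_real p) (of_real q) x * (N (of_real s) n)\<^sup>2)"
      proof (rule integral_mono)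
        fix x
        have "real_weight (of_real (s + n)) (of_real p) (of_real q) x * (norm (Gamma (complex_of_real (t + n))))\<^sup>2 \<le>
          real_weight (of_real (t + n)) (of_real p) (of_real q) x * (norm (Gamma (complex_of_real (s + n))))\<^sup>2"
          using assms by (intro real_weight_mono) auto
        then show "real_weight (of_real s + of_nat n) (of_real p) (of_real q) x * (N (of_real t) n)\<^sup>2 \<le>
          real_weight (of_real t + of_nat n) (of_real p) (of_real q) x * (N (of_real s) n)\<^sup>2"
          by (simp add: N_def)
      qed (use assms int in auto)
      then show ?thesis by (simp add: M_def)
    qed
    then have le: "M s \<le> M t * (N (of_real s) n)\<^sup>2 / (N (of_real t) n)\<^sup>2"
      using Npos[of t n] assms by (simp add: pos_le_divide_eq)
    have s: "s > 0" and t: "t > 0" using assms by auto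
    have "mass_ratio (of_real s) (of_real p) (of_real q) \<le> (M t * (N (of_real s) n)\<^sup>2 / (N (of_real t) n)\<^sup>2) /
      (N (of_real (s + p)) n * N (of_real (s + q)) n * norm (Gamma (complex_of_real (p + q))))"
      unfolding ratio[OF s] by (intro divide_right_mono le) (auto simp: N_def)
    also have "\<dots> = mass_ratio (of_real t) (of_real p) (of_real q) * c n"
    proof -
      have "N (of_real (t + p)) n > 0" "N (of_real (t + q)) n > 0"
        using assms by (auto intro!: Npos simp del: of_real_add)
      then show ?thesis unfolding ratio[OF t] c_def by (simp add: power2_eq_square)
    qed
    finally show ?thesis .
  qed
  moreover have "(\<lambda>n. mass_ratio (of_real t) (of_real p) (of_real q) * c n) \<longlonglongrightarrow>
      mass_ratio (of_real t) (of_real p) (of_real q) * 1"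
    by (intro tendsto_mult tendsto_const c)
  ultimately have "mass_ratio (of_real s) (of_real p) (of_real q) \<le> mass_ratio (of_real t) (of_real p) (of_real q) * 1"
    by (auto intro: LIMSEQ_le_const)
  then show ?thesis by simp
qed

text \<open>By periodicity t can be raised above s without changing the ratio, so monotonicity
  applies in both directions.\<close>

lemma mass_ratio_eq_real:
  assumes "0 < s" "0 < t" "0 < p" "0 < q"
  shows "mass_ratio (of_real s) (of_real p) (of_real q) = mass_ratio (of_real t) (of_real p) (of_real q)"
proof -
  have le: "mass_ratio (of_real s) (of_real p) (of_real q) \<le> mass_ratio (of_real t) (of_real p) (of_real q)"
    if st: "0 < s" "0 < t" for s t
  proof -
    obtain n :: nat where n: "s - t \<le> n" using real_arch_simple by blast
    have "mass_ratio (of_real s) (of_real p) (of_real q) \<le> mass_ratio (of_real (t + n)) (of_real p) (of_real q)"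
      using n st assms by (intro mass_ratio_mono_real) auto
    also have "\<dots> = mass_ratio (of_real t + of_nat n) (of_real p + of_nat 0) (of_real q)"
      by simp
    also have "\<dots> = mass_ratio (of_real t) (of_real p) (of_real q)"
      using assms st by (intro mass_ratio_shift[symmetric]) (auto simp: conj_closed_def)
    finally show ?thesis .
  qed
  show ?thesis using le[of s t] le[of t s] assms by auto
qed

text \<open>Constancy is available in the first place only; the symmetries bring each parameter
  there in turn to be replaced by 1/2.\<close>

lemma mass_ratio_real:
  assumes "0 < s" "0 < p" "0 < q"
  shows "mass_ratio (of_real s) (of_real p) (of_real q) = 4 * pi"
proof -
  define h where "h = complex_of_real (1 / 2)"
  have "mass_ratio (of_real s) (of_real p) (of_real q) = mass_ratio h (of_real p) (of_real q)"
    unfolding h_def using assms by (intro mass_ratio_eq_real) auto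
  also have "\<dots> = mass_ratio (of_real p) h (of_real q)" by (rule mass_ratio_swap12)
  also have "\<dots> = mass_ratio h h (of_real q)"
    unfolding h_def using assms by (intro mass_ratio_eq_real) auto
  also have "\<dots> = mass_ratio h (of_real q) h" by (rule mass_ratio_swap23)
  also have "\<dots> = mass_ratio (of_real q) h h" by (rule mass_ratio_swap12)
  also have "\<dots> = mass_ratio h h h"
    unfolding h_def using assms by (intro mass_ratio_eq_real) auto
  also have "\<dots> = 4 * pi"
  proof -
    have "conj_closed h h h" "Re h > 0" by (auto simp: h_def conj_closed_def)
    moreover have "h + h = 1" "mass h h h = 4 * of_real pi" using mass_half by (simp_all add: h_def)
    ultimately have "complex_of_real (mass_ratio h h h) = of_real (4 * pi)"
      using mass_ratio_eq[of h h h] by (simp only:) simp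
    then show ?thesis by (simp only: of_real_eq_iff)
  qed
  finally show ?thesis .
qed

lemma mass_ratio_pair:
  assumes \<alpha>: "0 < \<alpha>" and q: "0 < q"
  shows "mass_ratio (Complex \<alpha> \<beta>) (Complex \<alpha> (- \<beta>)) (of_real q) = 4 * pi"
proof -
  define N where "N z n = norm (Gamma (z + of_nat n))" for z :: complex and n
  define R where "R u = mass_ratio (Complex u \<beta>) (Complex u (- \<beta>)) (of_real q)" for u
  have conj: "conj_closed (Complex u \<beta>) (Complex u (- \<beta>)) (of_real q)" for u
    by (simp add: conj_closed_def complex_eq_iff)
  have shift: "R u = R (u + of_nat n)" if "u > 0" for u n
  proof -
    have "Complex u \<gamma> + of_nat n = Complex (u + of_nat n) \<gamma>" for \<gamma> by (simp add: complex_eq_iff)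
    then show ?thesis
      using that q conj[of u] conj[of "u + of_nat n"]
        mass_ratio_shift[of "Complex u \<beta>" "Complex u (- \<beta>)" "of_real q" n n]
      unfolding R_def by simp
  qed
  \<comment> \<open>The upper Gamma bound needs a real part larger than |\<beta>|; shifting both
    members of the pair by k achieves this without changing the ratio.\<close>
  obtain k :: nat where "\<bar>\<beta>\<bar> < k" using reals_Archimedean2 by blast
  define \<alpha>' where "\<alpha>' = \<alpha> + k"
  have \<alpha>': "\<bar>\<beta>\<bar> < \<alpha>'" "0 < \<alpha>'" using \<open>\<bar>\<beta>\<bar> < k\<close> \<alpha> by (auto simp: \<alpha>'_def)
  \<comment> \<open>The squares of \<open>e n\<close> and \<open>f n\<close> are the multiples in
    the lower and the upper estimate. The factor \<open>N 1 n\<close> cancels; it only pads the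
    quotients to four Gamma values.\<close>
  define e where "e n = (N (Complex \<alpha>' \<beta>) n * N (Complex \<alpha>' \<beta>) n * N (of_real (\<alpha>' + q)) n * N 1 n) /
    (N (of_real \<alpha>') n * N (of_real \<alpha>') n * N (Complex (\<alpha>' + q) \<beta>) n * N 1 n)" for n
  define f where "f n = (N (of_real (\<alpha>' + \<beta>)) n * N (of_real (\<alpha>' - \<beta>)) n * N (of_real (\<alpha>' + q)) n * N 1 n) /
    (N (of_real \<alpha>') n * N (of_real \<alpha>') n * N (Complex (\<alpha>' + q) \<beta>) n * N 1 n)" for n
  have e: "e \<longlonglongrightarrow> 1"
    unfolding e_def[abs_def] N_def by (rule norm_Gamma_ratio_tendsto_1) (use \<alpha>' q in auto)
  have f: "f \<longlonglongrightarrow> 1"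
    unfolding f_def[abs_def] N_def by (rule norm_Gamma_ratio_tendsto_1) (use \<alpha>' q in auto)
  have bounds: "4 * pi * (e n)\<^sup>2 \<le> R \<alpha>' \<and> R \<alpha>' \<le> 4 * pi * (f n)\<^sup>2" for n
  proof -
    define A where "A = \<alpha>' + n"
    have A: "A > \<bar>\<beta>\<bar>" "A > 0" using \<alpha>' by (auto simp: A_def)
    define M1 where "M1 = (LBINT x. real_weight (Complex A \<beta>) (Complex A (- \<beta>)) (of_real q) x)"
    define M0 where "M0 = (LBINT x. real_weight (of_real A) (of_real A) (of_real q) x)"
    define G where "G = norm (Gamma (complex_of_real A))"
    define g where "g = norm (Gamma (Complex A \<beta>))"
    define Gp where "Gp = norm (Gamma (complex_of_real (A + \<beta>)))"
    define Gm where "Gm = norm (Gamma (complex_of_real (A - \<beta>)))"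
    define Gq where "Gq = norm (Gamma (complex_of_real (A + q)))"
    define gq where "gq = norm (Gamma (Complex (A + q) \<beta>))"
    define G2 where "G2 = norm (Gamma (complex_of_real (2 * A)))"
    have pos: "G > 0" "g > 0" "Gp > 0" "Gm > 0" "Gq > 0" "gq > 0" "G2 > 0"
      unfolding G_def g_def Gp_def Gm_def Gq_def gq_def G2_def zero_less_norm_iff
      using A q by (auto intro!: Gamma_neq_0_Re_pos)
    have N1: "N 1 n > 0" unfolding N_def zero_less_norm_iff by (intro Gamma_neq_0_Re_pos) auto
    have N: "N (Complex u \<gamma>) n = norm (Gamma (Complex (u + n) \<gamma>))" "N (of_real u) n = norm (Gamma (complex_of_real (u + n)))"
      for u \<gamma>
      by (auto simp: N_def complex_eq_iff intro!: arg_cong[where f = Gamma] arg_cong[where f = norm])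
    have e_eq: "e n = g * g * Gq / (G * G * gq)"
      using N1 unfolding e_def N by (simp add: g_def Gq_def G_def gq_def A_def add_ac)
    have f_eq: "f n = Gp * Gm * Gq / (G * G * gq)"
    proof -
      have "\<alpha>' + n = A" "\<alpha>' + \<beta> + n = A + \<beta>" "\<alpha>' - \<beta> + n = A - \<beta>" "\<alpha>' + q + n = A + q"
        by (simp_all add: A_def)
      then show ?thesis
        unfolding f_def N Gp_def Gm_def Gq_def G_def gq_def using N1
        by (simp only:) (simp del: of_real_add of_real_diff)
    qed
    have R_eq: "R \<alpha>' = M1 / (G2 * gq\<^sup>2)"
    proof -
      have "Complex A \<beta> + Complex A (- \<beta>) = of_real (2 * A)" "Complex A \<beta> + of_real q = Complex (A + q) \<beta>"
        "Complex A (- \<beta>) + of_real q = cnj (Complex (A + q) \<beta>)"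
        by (auto simp: complex_eq_iff)
      moreover have "norm (Gamma (cnj z)) = norm (Gamma z)" for z by (metis cnj_Gamma complex_mod_cnj)
      ultimately have "R A = M1 / (G2 * gq\<^sup>2)"
        unfolding R_def mass_ratio_def M1_def G2_def gq_def power2_eq_square mult.assoc by (simp only:)
      then show ?thesis using shift[of \<alpha>' n] \<alpha>' by (simp add: A_def)
    qed
    have "M0 / (G2 * Gq\<^sup>2) = 4 * pi"
      using mass_ratio_real[of A A q] A q
      unfolding mass_ratio_def M0_def[symmetric] G2_def Gq_def power2_eq_square
      by (simp add: mult.assoc)
    \<comment> \<open>The reference integral with \<beta> = 0 has real parameters, so its value is
      already known.\<close>
    then have M0: "M0 = 4 * pi * (G2 * Gq\<^sup>2)" using pos by (simp add: divide_eq_eq)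
    define K where "K x = 2 * x * sinh (2 * pi * x) / pi * (norm (Gamma (of_real q + \<i> * of_real x)))\<^sup>2" for x
    have K: "K x \<ge> 0" for x unfolding K_def by (intro mult_nonneg_nonneg x_sinh_nonneg) auto
    define z where "z x = of_real A + \<i> * of_real x" for x
    have w1: "real_weight (Complex A \<beta>) (Complex A (- \<beta>)) (of_real q) x =
      K x * (norm (Gamma (z x + \<i> * of_real \<beta>)) * norm (Gamma (z x - \<i> * of_real \<beta>)))\<^sup>2" for x
    proof -
      have "Complex A \<beta> + \<i> * of_real x = z x + \<i> * of_real \<beta>" "Complex A (- \<beta>) + \<i> * of_real x = z x - \<i> * of_real \<beta>"
        by (auto simp: complex_eq_iff z_def)
      then show ?thesis by (simp add: real_weight_def K_def power_mult_distrib)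
    qed
    have w0: "real_weight (of_real A) (of_real A) (of_real q) x = K x * ((norm (Gamma (z x)))\<^sup>2)\<^sup>2" for x
      by (simp add: real_weight_def K_def z_def power2_eq_square)
    have int1: "integrable lborel (real_weight (Complex A \<beta>) (Complex A (- \<beta>)) (of_real q))"
      using A q by (intro integral_real_weight(1) conj) auto
    have int0: "integrable lborel (real_weight (of_real A) (of_real A) (of_real q))"
      using A q by (intro integral_real_weight(1)) (auto simp: conj_closed_def)
    have Gz: "Gamma (Re (z x)) = G" for x
      using A by (simp add: z_def G_def norm_Gamma_of_real)
    have "M0 * (g\<^sup>2)\<^sup>2 \<le> M1 * (G\<^sup>2)\<^sup>2"
    proof -
      have "(LBINT x. real_weight (of_real A) (of_real A) (of_real q) x * (g\<^sup>2)\<^sup>2) \<le>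
        (LBINT x. real_weight (Complex A \<beta>) (Complex A (- \<beta>)) (of_real q) x * (G\<^sup>2)\<^sup>2)"
      proof (rule integral_mono)
        fix x
        have "(norm (Gamma (z x)))\<^sup>2 * g\<^sup>2 \<le>
          norm (Gamma (z x + \<i> * of_real \<beta>)) * norm (Gamma (z x - \<i> * of_real \<beta>)) * G\<^sup>2"
          using norm_Gamma_shift_ge[of "z x" \<beta>] A unfolding Gz by (simp add: z_def g_def)
        then have "((norm (Gamma (z x)))\<^sup>2 * g\<^sup>2)\<^sup>2 \<le>
          (norm (Gamma (z x + \<i> * of_real \<beta>)) * norm (Gamma (z x - \<i> * of_real \<beta>)) * G\<^sup>2)\<^sup>2"
          by (intro power_mono) auto
        from mult_left_mono[OF this K[of x]]
        show "real_weight (of_real A) (of_real A) (of_real q) x * (g\<^sup>2)\<^sup>2 \<le>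
          real_weight (Complex A \<beta>) (Complex A (- \<beta>)) (of_real q) x * (G\<^sup>2)\<^sup>2"
          unfolding w0 w1 by (simp add: power_mult_distrib mult.assoc)
      qed (use int0 int1 in auto)
      then show ?thesis by (simp add: M0_def M1_def)
    qed
    then have low: "4 * pi * (e n)\<^sup>2 \<le> R \<alpha>'"
      unfolding e_eq R_eq M0 using pos by (simp add: field_simps power2_eq_square)
    have "M1 * (G\<^sup>2)\<^sup>2 \<le> M0 * (Gp * Gm)\<^sup>2"
    proof -
      have "(LBINT x. real_weight (Complex A \<beta>) (Complex A (- \<beta>)) (of_real q) x * (G\<^sup>2)\<^sup>2) \<le>
        (LBINT x. real_weight (of_real A) (of_real A) (of_real q) x * (Gp * Gm)\<^sup>2)"
      proof (rule integral_mono)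
        fix x
        have "norm (Gamma (z x + \<i> * of_real \<beta>)) * norm (Gamma (z x - \<i> * of_real \<beta>)) * G\<^sup>2 \<le>
          (norm (Gamma (z x)))\<^sup>2 * (Gp * Gm)"
          using norm_Gamma_shift_le[of \<beta> "z x"] A unfolding Gz
          by (simp add: z_def Gp_def Gm_def norm_Gamma_of_real mult.assoc del: of_real_add of_real_diff)
        then have "(norm (Gamma (z x + \<i> * of_real \<beta>)) * norm (Gamma (z x - \<i> * of_real \<beta>)) * G\<^sup>2)\<^sup>2 \<le>
          ((norm (Gamma (z x)))\<^sup>2 * (Gp * Gm))\<^sup>2"
          by (intro power_mono) auto
        from mult_left_mono[OF this K[of x]]
        show "real_weight (Complex A \<beta>) (Complex A (- \<beta>)) (of_real q) x * (G\<^sup>2)\<^sup>2 \<le>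
          real_weight (of_real A) (of_real A) (of_real q) x * (Gp * Gm)\<^sup>2"
          unfolding w0 w1 by (simp add: power_mult_distrib mult.assoc)
      qed (use int0 int1 in auto)
      then show ?thesis by (simp add: M0_def M1_def)
    qed
    then have "R \<alpha>' \<le> 4 * pi * (f n)\<^sup>2"
      unfolding f_eq R_eq M0 using pos by (simp add: field_simps power2_eq_square)
    with low show ?thesis ..
  qed
  have "(\<lambda>n. 4 * pi * (e n)\<^sup>2) \<longlonglongrightarrow> 4 * pi * 1\<^sup>2" "(\<lambda>n. 4 * pi * (f n)\<^sup>2) \<longlonglongrightarrow> 4 * pi * 1\<^sup>2"
    by (intro tendsto_mult tendsto_power tendsto_const e f)+
  then have "4 * pi * 1\<^sup>2 \<le> R \<alpha>'" "R \<alpha>' \<le> 4 * pi * 1\<^sup>2"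
    using bounds by (auto intro: LIMSEQ_le_const LIMSEQ_le_const2)
  then have "R \<alpha>' = 4 * pi" by simp
  then show ?thesis
    using shift[OF \<alpha>, of k] by (simp add: R_def \<alpha>'_def)
qed

lemma mass_formula:
  assumes pos: "Re a > 0" "Re b > 0" "Re d > 0" and conj: "conj_closed a b d"
  shows "mass a b d = 4 * of_real pi * (Gamma (a + b) * Gamma (a + d) * Gamma (b + d))"
proof -
  have pair: "mass_ratio p q r = 4 * pi" if "p = cnj q" "r \<in> \<real>" "Re q > 0" "Re r > 0" for p q r
  proof -
    have "p = Complex (Re q) (- Im q)" "q = Complex (Re q) (- (- Im q))" "r = of_real (Re r)"
      using that by (auto simp: complex_eq_iff elim!: Reals_cases)
    then show ?thesis using mass_ratio_pair[of "Re q" "Re r" "- Im q"] that by metis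
  qed
  have "mass_ratio a b d = 4 * pi"
    using conj unfolding conj_closed_def
  proof (elim disjE conjE)
    assume "a \<in> \<real>" "b \<in> \<real>" "d \<in> \<real>"
    then show ?thesis using mass_ratio_real pos by (auto elim!: Reals_cases)
  next
    assume "a = cnj b" "d \<in> \<real>"
    then show ?thesis using pair pos by blast
  next
    assume "a = cnj d" "b \<in> \<real>"
    then show ?thesis using pair pos mass_ratio_swap23[of a b d] by metis
  next
    assume "b = cnj d" "a \<in> \<real>"
    then show ?thesis using pair pos mass_ratio_swap12[of a b d] mass_ratio_swap23[of b a d] by metis
  qed
  then show ?thesis using mass_eq_mass_ratio[OF assms] by simp
qed

section \<open>Finite and infinite hypergeometric sums\<close>

text \<open>In this form it is visible that the symbol vanishes for j > i, which makes
  hypergeometric series terminate and lets finite sums be extended to a common range.\<close>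

lemma pochhammer_minus_of_nat:
  "pochhammer (- of_nat i) j = (- 1) ^ j * fact j * (of_nat (i choose j) :: 'a :: field_char_0)"
  by (simp add: binomial_gbinomial gbinomial_pochhammer flip: power_mult_distrib mult.assoc)

text \<open>The terms with i < j vanish. After the substitution i = l + j, binom(k, l + j) binom(l +
  j, j) = binom(k, j) binom(k - j, l) separates j from l, and the sum over l is the binomial theorem
  for rising factorials.\<close>

lemma sum_binomial_pochhammer_shifted:
  fixes p r :: "'a :: field_char_0"
  assumes "j \<le> k"
  shows "(\<Sum>i\<le>k. of_nat (k choose i) * pochhammer (- of_nat i) j * pochhammer p i * pochhammer r (k - i)) =
    pochhammer (- of_nat k) j * pochhammer p j * pochhammer (p + of_nat j + r) (k - j)"
proof -
  let ?f = "\<lambda>i. of_nat (k choose i) * pochhammer (- of_nat i) j * pochhammer p i * pochhammer r (k - i)"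
  have "(\<Sum>i\<le>k. ?f i) = (\<Sum>i\<in>{j..k}. ?f i)"
    by (rule sum.mono_neutral_right) (auto simp: pochhammer_minus_of_nat binomial_eq_0)
  also have "\<dots> = (\<Sum>l\<le>k - j. ?f (l + j))"
    using assms by (intro sum.reindex_bij_witness[of _ "\<lambda>l. l + j" "\<lambda>i. i - j"]) auto
  also have "\<dots> = (\<Sum>l\<le>k - j. pochhammer (- of_nat k) j * pochhammer p j *
      (of_nat ((k - j) choose l) * pochhammer (p + of_nat j) l * pochhammer r (k - j - l)))"
  proof (rule sum.cong)
    fix l assume "l \<in> {..k - j}"
    then have "(k choose (l + j)) * ((l + j) choose j) = (k choose j) * ((k - j) choose l)"
      using assms choose_mult[of j "l + j" k] by simp
    then have "(of_nat (k choose (l + j)) * of_nat ((l + j) choose j) :: 'a) = of_nat (k choose j) * of_nat ((k - j) choose l)"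
      by (simp only: flip: of_nat_mult)
    moreover have "pochhammer p (l + j) = pochhammer p j * pochhammer (p + of_nat j) l"
      using pochhammer_product'[of p j l] by (simp add: add.commute)
    moreover have "k - (l + j) = k - j - l" by simp
    ultimately show "?f (l + j) = pochhammer (- of_nat k) j * pochhammer p j *
      (of_nat ((k - j) choose l) * pochhammer (p + of_nat j) l * pochhammer r (k - j - l))"
      unfolding pochhammer_minus_of_nat by (simp only:) (simp add: mult_ac)
  qed simp
  also have "\<dots> = pochhammer (- of_nat k) j * pochhammer p j * pochhammer (p + of_nat j + r) (k - j)"
    by (simp only: pochhammer_binomial_sum sum_distrib_left)
  finally show ?thesis .
qed

text \<open>The range extends to k instead of i so that, inside a double sum, it does not depend on
  the outer index and the sums can be swapped.\<close>

lemma Vandermonde_pochhammer_atMost: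
  fixes s q :: "'a :: field_char_0"
  assumes s: "\<And>i. s \<noteq> - of_nat i" and "i \<le> k"
  shows "(\<Sum>j\<le>k. pochhammer q j * pochhammer (- of_nat i) j / (fact j * pochhammer s j)) =
    pochhammer (s - q) i / pochhammer s i"
proof -
  have "(\<Sum>j\<le>k. pochhammer q j * pochhammer (- of_nat i) j / (fact j * pochhammer s j)) =
    (\<Sum>j\<in>{0..i}. pochhammer q j * pochhammer (- of_nat i) j / (fact j * pochhammer s j))"
    using assms(2) by (intro sum.mono_neutral_right) (auto simp: pochhammer_minus_of_nat binomial_eq_0)
  also have "\<dots> = pochhammer (s - q) i / pochhammer s i"
    using Vandermonde_pochhammer[of i s q] s by simp
  finally show ?thesis .
qed

text \<open>
  For \<open>p = a + ix\<close>, \<open>q = a - ix\<close>, \<open>s = a + b\<close>, \<open>e = a + d\<close> the right-hand side is symmetric in \<open>a\<close> and \<open>b\<close>.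
\<close>
lemma terminating_3F2_transformation:
  fixes p q s e :: "'a :: field_char_0"
  assumes s: "\<And>i. s \<noteq> - of_nat i" and e: "\<And>i. e \<noteq> - of_nat i"
  shows "pochhammer e k * (\<Sum>j\<le>k. pochhammer (- of_nat k) j * pochhammer p j * pochhammer q j /
      (pochhammer s j * pochhammer e j * fact j)) =
    (\<Sum>i\<le>k. of_nat (k choose i) * pochhammer (e - p) (k - i) * pochhammer p i *
      (pochhammer (s - q) i / pochhammer s i))"
proof -
  \<comment> \<open>The calculation starts from the symmetric side: Vandermonde's identity, read
    backwards, turns each quotient into a sum over j. Once the sums are swapped, the sum over i has
    a closed form.\<close>
  have "(\<Sum>i\<le>k. of_nat (k choose i) * pochhammer (e - p) (k - i) * pochhammer p i *
      (pochhammer (s - q) i / pochhammer s i)) =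
    (\<Sum>i\<le>k. \<Sum>j\<le>k. pochhammer q j / (fact j * pochhammer s j) *
       (of_nat (k choose i) * pochhammer (- of_nat i) j * pochhammer p i * pochhammer (e - p) (k - i)))"
    by (intro sum.cong refl)
      (simp add: Vandermonde_pochhammer_atMost[OF s, symmetric] sum_distrib_left mult_ac)
  also have "\<dots> = (\<Sum>j\<le>k. pochhammer q j / (fact j * pochhammer s j) *
     (\<Sum>i\<le>k. of_nat (k choose i) * pochhammer (- of_nat i) j * pochhammer p i * pochhammer (e - p) (k - i)))"
    by (subst sum.swap) (simp only: sum_distrib_left)
  also have "\<dots> = (\<Sum>j\<le>k. pochhammer e k * (pochhammer (- of_nat k) j * pochhammer p j * pochhammer q j /
      (pochhammer s j * pochhammer e j * fact j)))"
  proof (intro sum.cong refl)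
    fix j assume "j \<in> {..k}"
    then have j: "j \<le> k" by simp
    have "pochhammer e k = pochhammer e j * pochhammer (e + of_nat j) (k - j)"
      using j by (rule pochhammer_product)
    moreover have eq: "p + of_nat j + (e - p) = e + of_nat j" by simp
    moreover have "pochhammer e j \<noteq> 0" using e by (auto simp: pochhammer_eq_0_iff)
    ultimately show "pochhammer q j / (fact j * pochhammer s j) *
     (\<Sum>i\<le>k. of_nat (k choose i) * pochhammer (- of_nat i) j * pochhammer p i * pochhammer (e - p) (k - i)) =
     pochhammer e k * (pochhammer (- of_nat k) j * pochhammer p j * pochhammer q j /
      (pochhammer s j * pochhammer e j * fact j))"
      unfolding sum_binomial_pochhammer_shifted[OF j] eq by (simp add: divide_simps)
  qed
  finally show ?thesis by (simp only: sum_distrib_left)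
qed

lemma neq_minus_of_nat_if_Re_pos: "Re s > 0 \<Longrightarrow> s \<noteq> - of_nat i"
  by (auto simp: complex_eq_iff)

lemma pochhammer_neq_0_Re_pos: "Re s > 0 \<Longrightarrow> pochhammer s n \<noteq> 0"
  using neq_minus_of_nat_if_Re_pos by (auto simp: pochhammer_eq_0_iff)

text \<open>The factor with a + d is grouped with the sum so that this product matches the left-hand
  side of the transformation.\<close>

lemma cont_dual_Hahn_eq_sum:
  "cont_dual_Hahn k a b d x = pochhammer (a + b) k * (pochhammer (a + d) k *
     (\<Sum>j\<le>k. pochhammer (- of_nat k) j * pochhammer (a + \<i> * x) j * pochhammer (a - \<i> * x) j /
      (pochhammer (a + b) j * pochhammer (a + d) j * fact j)))"
proof -
  have "pFq [- of_nat k, a + \<i> * x, a - \<i> * x] [a + b, a + d] 1 =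
    (\<Sum>j. pochhammer (- of_nat k) j * pochhammer (a + \<i> * x) j * pochhammer (a - \<i> * x) j /
      (pochhammer (a + b) j * pochhammer (a + d) j * fact j))"
    by (simp add: pFq_altdef mult.assoc)
  also have "\<dots> = (\<Sum>j\<le>k. pochhammer (- of_nat k) j * pochhammer (a + \<i> * x) j * pochhammer (a - \<i> * x) j /
      (pochhammer (a + b) j * pochhammer (a + d) j * fact j))"
    by (rule suminf_finite) (auto simp: pochhammer_minus_of_nat binomial_eq_0)
  finally show ?thesis by (simp add: cont_dual_Hahn_def)
qed

lemma cont_dual_Hahn_swap:
  assumes "Re a > 0" "Re b > 0" "Re d > 0"
  shows "cont_dual_Hahn k a b d x = cont_dual_Hahn k b a d x"
proof -
  have eq: "cont_dual_Hahn k a b d x = pochhammer (a + b) k *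
    (\<Sum>i\<le>k. of_nat (k choose i) * pochhammer (d - \<i> * x) (k - i) * pochhammer (a + \<i> * x) i *
      (pochhammer (b + \<i> * x) i / pochhammer (a + b) i))"
    if "Re a > 0" "Re b > 0" for a b
  proof -
    have "a + b - (a - \<i> * x) = b + \<i> * x" "a + d - (a + \<i> * x) = d - \<i> * x" by simp_all
    then show ?thesis
      unfolding cont_dual_Hahn_eq_sum
      using terminating_3F2_transformation[of "a + b" "a + d" k "a + \<i> * x" "a - \<i> * x"] that assms(3)
        neq_minus_of_nat_if_Re_pos[of "a + b"] neq_minus_of_nat_if_Re_pos[of "a + d"]
      by simp
  qed
  show ?thesis unfolding eq[OF assms(1,2)] eq[OF assms(2,1)]
    by (simp add: mult_ac add.commute[of b a])
qed

section \<open>Convergence of the series and Kummer's transformation\<close>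

lemma tendsto_inverse_add_of_nat: "(\<lambda>n. inverse (s + of_nat n)) \<longlonglongrightarrow> (0 :: complex)"
  by (rule filterlim_compose[OF tendsto_inverse_0])
    (intro tendsto_add_filterlim_at_infinity[OF tendsto_const] tendsto_of_nat)

text \<open>There is one more Pochhammer symbol below the bar than above, so the quotient of
  consecutive terms tends to 0 for every z. With t = 1 this covers the confluent series; it also
  supplies the majorant for the integrand.\<close>

lemma summable_pochhammer_ratio:
  fixes \<alpha> s t z :: complex
  assumes s: "Re s > 0" and t: "Re t > 0"
  shows "summable (\<lambda>n. norm (pochhammer \<alpha> n / (pochhammer s n * pochhammer t n) * z ^ n))"
proof -
  define f where "f n = pochhammer \<alpha> n / (pochhammer s n * pochhammer t n) * z ^ n" for n
  define g where "g n = (1 + (\<alpha> - s) * inverse (s + of_nat n)) * inverse (t + of_nat n) * z" for n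
  have f_Suc: "f (Suc n) = f n * g n" for n
  proof -
    have "s + of_nat n \<noteq> 0" "t + of_nat n \<noteq> 0"
      using neq_minus_of_nat_if_Re_pos[OF s, of n] neq_minus_of_nat_if_Re_pos[OF t, of n]
      by (simp_all add: add_eq_0_iff2)
    moreover from this have "1 + (\<alpha> - s) * inverse (s + of_nat n) = (\<alpha> + of_nat n) * inverse (s + of_nat n)"
      by (simp add: field_simps)
    ultimately show ?thesis
      by (simp add: f_def g_def pochhammer_Suc divide_inverse mult_ac)
  qed
  have "g \<longlonglongrightarrow> (1 + (\<alpha> - s) * 0) * 0 * z"
    unfolding g_def[abs_def]
    by (intro tendsto_mult tendsto_add tendsto_const tendsto_inverse_add_of_nat)
  then have "\<forall>\<^sub>F n in sequentially. norm (g n) < 1 / 2"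
    using order_tendstoD(2)[OF tendsto_norm, of g 0 sequentially "1 / 2"] by simp
  then obtain N where N: "\<And>n. n \<ge> N \<Longrightarrow> norm (g n) < 1 / 2"
    by (auto simp: eventually_sequentially)
  have "summable (\<lambda>n. norm (f n))"
  proof (rule summable_ratio_test)
    show "norm (norm (f (Suc n))) \<le> 1 / 2 * norm (norm (f n))" if "n \<ge> N" for n
      using mult_right_mono[OF less_imp_le[OF N[OF that]], of "norm (f n)"]
      by (simp add: f_Suc norm_mult mult.commute)
  qed simp
  then show ?thesis by (simp add: f_def)
qed

lemma summable_1F1:
  fixes \<alpha> \<gamma> z :: complex
  assumes "Re \<gamma> > 0"
  shows "summable (\<lambda>n. norm (pochhammer \<alpha> n / pochhammer \<gamma> n * (z ^ n / fact n)))"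
  using summable_pochhammer_ratio[OF assms, of 1 \<alpha> z] by (simp flip: pochhammer_fact)

text \<open>In the Cauchy product with the exponential series, each coefficient is a terminating sum
  of Vandermonde type.\<close>

lemma Kummer_transformation:
  fixes \<alpha> \<gamma> z :: complex
  assumes \<gamma>: "Re \<gamma> > 0"
  shows "exp z * pFq [\<alpha>] [\<gamma>] (- z) = pFq [\<gamma> - \<alpha>] [\<gamma>] z"
proof -
  define u where "u n = pochhammer \<alpha> n / pochhammer \<gamma> n * ((- z) ^ n / fact n)" for n
  define v where "v n = z ^ n / fact n" for n
  have v: "summable (\<lambda>n. norm (v n))" "(\<Sum>n. v n) = exp z"
    using summable_norm_exp[of z] unfolding v_def exp_def by (simp_all add: scaleR_conv_of_real divide_inverse mult.commute)
  have "pFq [\<alpha>] [\<gamma>] (- z) * exp z = (\<Sum>n. u n) * (\<Sum>n. v n)"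
    by (simp add: pFq_altdef v u_def)
  also have "\<dots> = (\<Sum>n. \<Sum>i\<le>n. u i * v (n - i))"
    using summable_1F1[OF \<gamma>, of \<alpha> "- z"] v(1) by (intro Cauchy_product) (simp_all add: u_def)
  also have "\<dots> = (\<Sum>n. pochhammer (\<gamma> - \<alpha>) n / pochhammer \<gamma> n * (z ^ n / fact n))"
  proof (intro suminf_cong)
    fix n
    have "u i * v (n - i) = z ^ n / fact n * (pochhammer \<alpha> i * pochhammer (- of_nat n) i / (fact i * pochhammer \<gamma> i))"
      if "i \<le> n" for i
    proof -
      have "z ^ n = z ^ i * z ^ (n - i)" using that by (simp flip: power_add)
      moreover have "(- z) ^ i = (- 1) ^ i * z ^ i" by (rule power_minus)
      moreover have "(of_nat (n choose i) :: complex) = fact n / (fact i * fact (n - i))"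
        using that by (rule binomial_fact)
      ultimately show ?thesis
        by (simp add: u_def v_def pochhammer_minus_of_nat divide_simps)
    qed
    then have "(\<Sum>i\<le>n. u i * v (n - i)) = z ^ n / fact n *
       (\<Sum>i\<le>n. pochhammer \<alpha> i * pochhammer (- of_nat n) i / (fact i * pochhammer \<gamma> i))"
      by (simp add: sum_distrib_left)
    then show "(\<Sum>i\<le>n. u i * v (n - i)) = pochhammer (\<gamma> - \<alpha>) n / pochhammer \<gamma> n * (z ^ n / fact n)"
      using Vandermonde_pochhammer_atMost[OF neq_minus_of_nat_if_Re_pos[OF \<gamma>], of n n \<alpha>] by (simp add: mult_ac)
  qed
  finally show ?thesis by (simp add: pFq_altdef mult.commute)
qed

section \<open>The integral formula\<close>

lemma conj_closed_if_real_or_conj_pair: "real_or_conj_pair [a, b, d] \<Longrightarrow> conj_closed a b d"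
  by (auto simp: real_or_conj_pair_def conj_closed_def split: if_splits)

lemma norm_Gamma_imaginary_sq:
  assumes "x \<noteq> 0"
  shows "(norm (Gamma (\<i> * of_real x)))\<^sup>2 = pi / (x * sinh (pi * x))"
proof -
  have sin: "sin (\<i> * of_real (pi * x)) = \<i> * of_real (sinh (pi * x))"
  proof -
    have "(of_real (sinh (pi * x)) :: complex) = - \<i> * sin (\<i> * of_real (pi * x))"
      using sinh_real[of "pi * x"] by (simp only: sinh_field_def exp_minus)
    then have "\<i> * of_real (sinh (pi * x)) = \<i> * (- \<i> * sin (\<i> * of_real (pi * x)))"
      by (rule arg_cong)
    then show ?thesis by (simp add: complex_eq_iff)
  qed
  have "of_real ((norm (Gamma (\<i> * of_real x)))\<^sup>2) = Gamma (\<i> * of_real x) * Gamma (- (\<i> * of_real x))"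
    unfolding norm_Gamma_square by simp
  also have "\<dots> = - of_real pi / (\<i> * of_real x * sin (of_real pi * (\<i> * of_real x)))"
    by (rule Gamma_reflection_complex')
  also have "of_real pi * (\<i> * of_real x) = \<i> * of_real (pi * x)" by simp
  also have "\<i> * of_real x * sin (\<i> * of_real (pi * x)) = (\<i> * \<i>) * of_real (x * sinh (pi * x))"
    unfolding sin by (simp only: of_real_mult mult_ac)
  also have "- of_real pi / (\<i> * \<i> * of_real (x * sinh (pi * x))) = complex_of_real (pi / (x * sinh (pi * x)))"
    by simp
  finally show ?thesis by (simp only: of_real_eq_iff)
qed

lemma norm_Gamma_quotient_eq_weight:
  assumes "conj_closed a b d" "x \<noteq> 0"
  shows "of_real ((norm (Gamma (a + \<i> * of_real x) * Gamma (b + \<i> * of_real x) *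
    Gamma (d + \<i> * of_real x) / Gamma (2 * \<i> * of_real x)))\<^sup>2) = weight a b d x"
proof -
  have "2 * \<i> * complex_of_real x = \<i> * of_real (2 * x)" by simp
  then have "(norm (Gamma (2 * \<i> * of_real x)))\<^sup>2 = pi / (2 * x * sinh (2 * pi * x))"
    using norm_Gamma_imaginary_sq[of "2 * x"] assms(2) by (simp add: mult_ac)
  then have "(norm (Gamma (a + \<i> * of_real x) * Gamma (b + \<i> * of_real x) *
    Gamma (d + \<i> * of_real x) / Gamma (2 * \<i> * of_real x)))\<^sup>2 = real_weight a b d x"
    by (simp add: norm_mult norm_divide power_mult_distrib power_divide real_weight_def)
  then show ?thesis by (simp only: weight_eq_real_weight[OF assms(1)])
qed

lemma weight_plus_of_nat:
  assumes "Re a > 0"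
  shows "weight (a + of_nat n) b d x =
    pochhammer (a + \<i> * of_real x) n * pochhammer (a - \<i> * of_real x) n * weight a b d x"
proof (induction n)
  case (Suc n)
  have "weight (a + of_nat (Suc n)) b d x = weight (a + of_nat n + 1) b d x" by (simp add: add_ac)
  also have "\<dots> = ((a + of_nat n)\<^sup>2 + of_real (x\<^sup>2)) * weight (a + of_nat n) b d x"
    using assms by (intro weight_plus_1) simp
  also have "(a + of_nat n)\<^sup>2 + of_real (x\<^sup>2) = (a + \<i> * of_real x + of_nat n) * (a - \<i> * of_real x + of_nat n)"
    by (simp add: algebra_simps power2_eq_square)
  finally show ?case unfolding Suc pochhammer_Suc by (simp only: mult_ac)
qed simp

section \<open>Reduction to the whole line and bounds for termwise integration\<close>

lemma integral_even_halfline: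
  fixes g :: "real \<Rightarrow> complex"
  assumes g: "integrable lborel g" and even: "\<And>x. g (- x) = g x"
  shows "(LINT x:{0<..}|lborel. g x) = (LBINT x. g x) / 2"
proof -
  have pos: "integrable lborel (\<lambda>x. indicator {0<..} x *\<^sub>R g x)"
    using g by (intro integrable_mult_indicator) auto
  have neg: "integrable lborel (\<lambda>x. indicator {..<0} x *\<^sub>R g x)"
    using g by (intro integrable_mult_indicator) auto
  have "(LBINT x. g x) = (LBINT x. indicator {0<..} x *\<^sub>R g x + indicator {..<0} x *\<^sub>R g x)"
  proof (rule integral_cong_AE)
    show "AE x in lborel. g x = indicator {0<..} x *\<^sub>R g x + indicator {..<0} x *\<^sub>R g x"
      using AE_lborel_singleton[of 0] by eventually_elim (auto simp: indicator_def)
  qed (use g pos neg in auto)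
  also have "\<dots> = (LBINT x. indicator {0<..} x *\<^sub>R g x) + (LBINT x. indicator {..<0} x *\<^sub>R g x)"
    using pos neg by (rule Bochner_Integration.integral_add)
  also have "(LBINT x. indicator {..<0} x *\<^sub>R g x) = (LBINT x. indicator {0<..} x *\<^sub>R g x)"
    by (subst lborel_integral_real_affine[where c = "- 1" and t = 0])
      (auto simp: even indicator_def intro!: Bochner_Integration.integral_cong)
  finally show ?thesis by (simp add: set_lebesgue_integral_def)
qed

text \<open>A power t^(2n) is traded for (2n)! and an exponential of small rate, and (2n)! \<le> 4^n
  (n!)^2. The growth (n!)^2 is affordable: dividing by n! and two further Pochhammer symbols of
  index n leaves a series that converges for every \<rho>.\<close>

lemma norm_pochhammer_pair_le:
  fixes a :: complex and x :: real
  assumes "\<epsilon> > 0"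
  shows "norm (pochhammer (a + \<i> * of_real x) n * pochhammer (a - \<i> * of_real x) n) \<le>
    exp (\<epsilon> * norm a) * ((4 * exp \<epsilon> / \<epsilon>\<^sup>2) ^ n * (fact n)\<^sup>2) * exp (\<epsilon> * \<bar>x\<bar>)"
proof -
  define t where "t = norm a + \<bar>x\<bar> + n"
  have le: "norm (pochhammer z n) \<le> t ^ n" if "norm z \<le> norm a + \<bar>x\<bar>" for z :: complex
    using that by (intro order.trans[OF norm_pochhammer_le] power_mono) (auto simp: t_def)
  have "norm (pochhammer (a + \<i> * of_real x) n * pochhammer (a - \<i> * of_real x) n) \<le> t ^ n * t ^ n"
    unfolding norm_mult
  proof (intro mult_mono le)
    show "norm (a + \<i> * of_real x) \<le> norm a + \<bar>x\<bar>"
      using norm_triangle_ineq[of a "\<i> * of_real x"] by (simp add: norm_mult)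
    show "norm (a - \<i> * of_real x) \<le> norm a + \<bar>x\<bar>"
      using norm_triangle_ineq4[of a "\<i> * of_real x"] by (simp add: norm_mult)
  qed (auto simp: t_def)
  also have "\<dots> = t ^ (2 * n)" by (simp add: mult_2 power_add)
  also have "\<dots> \<le> fact (2 * n) / \<epsilon> ^ (2 * n) * exp (\<epsilon> * t)"
    using assms by (intro power_le_fact_exp) (auto simp: t_def)
  also have "\<dots> \<le> (4 ^ n * (fact n)\<^sup>2) / \<epsilon> ^ (2 * n) * exp (\<epsilon> * t)"
  proof (intro mult_right_mono divide_right_mono)
    have "(fact (2 * n) :: real) = (fact n)\<^sup>2 * of_nat (2 * n choose n)"
      by (simp add: binomial_fact power2_eq_square mult_2)
    also have "\<dots> \<le> (fact n)\<^sup>2 * 2 ^ (2 * n)"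
    proof (intro mult_left_mono)
      have "(2 * n choose n) \<le> 2 ^ (2 * n)" by (rule binomial_le_pow2)
      then show "real (2 * n choose n) \<le> 2 ^ (2 * n)"
        by (metis of_nat_le_iff of_nat_power of_nat_numeral)
    qed auto
    also have "(2 :: real) ^ (2 * n) = 4 ^ n" by (simp add: power_mult)
    finally show "(fact (2 * n) :: real) \<le> 4 ^ n * (fact n)\<^sup>2"
      by (simp only: mult.commute)
  qed (use assms in auto)
  also have "exp (\<epsilon> * t) = exp (\<epsilon> * norm a) * exp (\<epsilon> * \<bar>x\<bar>) * exp \<epsilon> ^ n"
    by (simp add: t_def distrib_left exp_add mult_ac flip: exp_of_nat_mult)
  also have "(4 ^ n * (fact n)\<^sup>2) / \<epsilon> ^ (2 * n) * (exp (\<epsilon> * norm a) * exp (\<epsilon> * \<bar>x\<bar>) * exp \<epsilon> ^ n) =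
     exp (\<epsilon> * norm a) * ((4 * exp \<epsilon> / \<epsilon>\<^sup>2) ^ n * (fact n)\<^sup>2) * exp (\<epsilon> * \<bar>x\<bar>)"
    by (simp add: power_mult_distrib power_divide mult_ac flip: power_mult)
  finally show ?thesis .
qed

definition hyp_term :: "complex \<Rightarrow> complex \<Rightarrow> complex \<Rightarrow> complex \<Rightarrow> nat \<Rightarrow> real \<Rightarrow> complex" where
  "hyp_term a b c \<rho> n x = pochhammer (a + \<i> * of_real x) n * pochhammer (a - \<i> * of_real x) n /
     (pochhammer (a + b) n * pochhammer (a + c) n) * ((- \<rho>) ^ n / fact n)"

text \<open>The bound separates n from x, and its growth in x has an arbitrarily small rate, which
  the decay of the weight can absorb.\<close>

lemma hyp_term_bound:
  assumes "Re (a + b) > 0" "Re (a + c) > 0" "\<epsilon> > 0"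
  obtains M where "summable M" "\<And>n. M n \<ge> 0" "\<And>n x. norm (hyp_term a b c \<rho> n x) \<le> M n * exp (\<epsilon> * \<bar>x\<bar>)"
proof -
  define r where "r = 4 * exp \<epsilon> / \<epsilon>\<^sup>2"
  have r: "r > 0" using assms(3) by (simp add: r_def)
  \<comment> \<open>The symbol (1)_n = n! is what remains of the bound (n!)^2 after division by the
    n! of the series.\<close>
  define u where "u n = norm (pochhammer 1 n / (pochhammer (a + b) n * pochhammer (a + c) n) * (of_real r * \<rho>) ^ n)" for n
  define M where "M n = exp (\<epsilon> * norm a) * u n" for n
  show ?thesis
  proof
    show "summable M"
      unfolding M_def u_def by (intro summable_mult summable_pochhammer_ratio assms)
    show "M n \<ge> 0" for n by (simp add: M_def u_def)
    show "norm (hyp_term a b c \<rho> n x) \<le> M n * exp (\<epsilon> * \<bar>x\<bar>)" for n x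
    proof -
      define D where "D = norm (pochhammer (a + b) n * pochhammer (a + c) n)"
      have "norm (hyp_term a b c \<rho> n x) =
        norm (pochhammer (a + \<i> * of_real x) n * pochhammer (a - \<i> * of_real x) n) * (norm \<rho> ^ n / (D * fact n))"
        by (simp add: hyp_term_def D_def norm_mult norm_divide norm_power)
      also have "\<dots> \<le> (exp (\<epsilon> * norm a) * (r ^ n * (fact n)\<^sup>2) * exp (\<epsilon> * \<bar>x\<bar>)) * (norm \<rho> ^ n / (D * fact n))"
        unfolding r_def by (intro mult_right_mono norm_pochhammer_pair_le assms) (auto simp: D_def)
      also have "\<dots> = M n * exp (\<epsilon> * \<bar>x\<bar>)"
        using r by (simp add: M_def u_def D_def norm_mult norm_divide norm_power power_mult_distrib
            pochhammer_fact[symmetric] power2_eq_square)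
      finally show ?thesis .
    qed
  qed
qed

text \<open>The coefficient of (b + ix)_j (b - ix)_j in the polynomial expanded in base b.\<close>

definition Hahn_coeff :: "nat \<Rightarrow> complex \<Rightarrow> complex \<Rightarrow> complex \<Rightarrow> nat \<Rightarrow> complex" where
  "Hahn_coeff k a b d j = pochhammer (a + b) k * pochhammer (b + d) k *
     (pochhammer (- of_nat k) j / (pochhammer (a + b) j * pochhammer (b + d) j * fact j))"

lemma weight_times_cont_dual_Hahn:
  assumes "Re a > 0" "Re b > 0" "Re d > 0"
  shows "weight a b d x * cont_dual_Hahn k a b d (of_real x) =
    (\<Sum>j\<le>k. Hahn_coeff k a b d j * weight a (b + of_nat j) d x)"
proof -
  have w: "weight a (b + of_nat j) d x =
    pochhammer (b + \<i> * of_real x) j * pochhammer (b - \<i> * of_real x) j * weight a b d x" for j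
    using weight_plus_of_nat[OF assms(2), of j a d x] by (simp add: weight_swap12[of a])
  have "cont_dual_Hahn k a b d (of_real x) = cont_dual_Hahn k b a d (of_real x)"
    by (rule cont_dual_Hahn_swap[OF assms])
  then show ?thesis
    by (simp add: cont_dual_Hahn_eq_sum sum_distrib_left w Hahn_coeff_def mult_ac add.commute[of b a])
qed

text \<open>The symbols of b + d with index j cancel, and Vandermonde's identity gives (a + b - (a +
  b + n))_k = (-n)_k. The result vanishes for n < k, which is the orthogonality of the polynomial to
  lower degrees.\<close>

lemma moment_cont_dual_Hahn:
  assumes "Re a > 0" "Re b > 0" "Re d > 0"
  shows "(\<Sum>j\<le>k. Hahn_coeff k a b d j * mass (a + of_nat n) (b + of_nat j) d) =
    pochhammer (a + b) n * pochhammer (a + d) n * pochhammer (b + d) k * pochhammer (- of_nat n) k * mass a b d"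
proof -
  have ab: "Re (a + b) > 0" and bd: "Re (b + d) > 0" using assms by auto
  define C where "C = pochhammer (a + b) k * pochhammer (b + d) k * pochhammer (a + b) n * pochhammer (a + d) n * mass a b d"
  have "Hahn_coeff k a b d j * mass (a + of_nat n) (b + of_nat j) d =
     C * (pochhammer (a + b + of_nat n) j * pochhammer (- of_nat k) j / (fact j * pochhammer (a + b) j))" for j
    unfolding mass_pochhammer2[OF assms] Hahn_coeff_def C_def pochhammer_product'[of "a + b" n j]
    using pochhammer_neq_0_Re_pos[OF bd, of j] by (simp add: mult_ac)
  then have "(\<Sum>j\<le>k. Hahn_coeff k a b d j * mass (a + of_nat n) (b + of_nat j) d) =
     C * (\<Sum>j\<le>k. pochhammer (a + b + of_nat n) j * pochhammer (- of_nat k) j / (fact j * pochhammer (a + b) j))"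
    by (simp add: sum_distrib_left)
  also have "(\<Sum>j\<le>k. pochhammer (a + b + of_nat n) j * pochhammer (- of_nat k) j / (fact j * pochhammer (a + b) j)) =
     pochhammer (a + b - (a + b + of_nat n)) k / pochhammer (a + b) k"
    by (rule Vandermonde_pochhammer_atMost[OF neq_minus_of_nat_if_Re_pos[OF ab]]) simp
  finally show ?thesis using pochhammer_neq_0_Re_pos[OF ab, of k] by (simp add: C_def)
qed

lemma weight_times_cont_dual_Hahn_decay:
  assumes "Re a > 0" "Re b > 0" "Re d > 0"
  obtains C where "C \<ge> 0"
    "\<And>x. norm (weight a b d x * cont_dual_Hahn k a b d (of_real x)) \<le> C * exp (- (1 / 2) * \<bar>x\<bar>)"
proof -
  have "\<exists>C. C > 0 \<and> (\<forall>x. norm (weight a (b + of_nat j) d x) \<le> C * exp (- (1 / 2) * \<bar>x\<bar>))" for j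
    using weight_decay[of a "b + of_nat j" d] assms by auto
  then obtain C where C: "\<And>j. C j > 0"
    "\<And>j x. norm (weight a (b + of_nat j) d x) \<le> C j * exp (- (1 / 2) * \<bar>x\<bar>)"
    by metis
  show ?thesis
  proof
    show "0 \<le> (\<Sum>j\<le>k. norm (Hahn_coeff k a b d j) * C j)"
      using C(1) by (intro sum_nonneg mult_nonneg_nonneg) (auto intro: less_imp_le)
    show "norm (weight a b d x * cont_dual_Hahn k a b d (of_real x)) \<le>
      (\<Sum>j\<le>k. norm (Hahn_coeff k a b d j) * C j) * exp (- (1 / 2) * \<bar>x\<bar>)" for x
      unfolding weight_times_cont_dual_Hahn[OF assms] sum_distrib_right
    proof (rule order.trans[OF norm_sum], rule sum_mono)
      show "norm (Hahn_coeff k a b d j * weight a (b + of_nat j) d x) \<le>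
        norm (Hahn_coeff k a b d j) * C j * exp (- (1 / 2) * \<bar>x\<bar>)" for j
        unfolding norm_mult mult.assoc by (intro mult_left_mono C(2) norm_ge_zero)
    qed
  qed
qed

lemma hyp_term_times_weight:
  assumes "Re a > 0" "Re b > 0" "Re d > 0"
  shows "hyp_term a b c \<rho> n x * (weight a b d x * cont_dual_Hahn k a b d (of_real x)) =
    (- \<rho>) ^ n / (fact n * pochhammer (a + b) n * pochhammer (a + c) n) *
      (\<Sum>j\<le>k. Hahn_coeff k a b d j * weight (a + of_nat n) (b + of_nat j) d x)"
  unfolding weight_times_cont_dual_Hahn[OF assms] weight_plus_of_nat[OF assms(1)] hyp_term_def
  by (simp add: sum_distrib_left sum_divide_distrib mult_ac)

lemma integral_hyp_term:
  assumes "Re a > 0" "Re b > 0" "Re c > 0" "Re d > 0"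
  shows "integrable lborel (\<lambda>x. hyp_term a b c \<rho> n x * (weight a b d x * cont_dual_Hahn k a b d (of_real x)))"
    and "(LBINT x. hyp_term a b c \<rho> n x * (weight a b d x * cont_dual_Hahn k a b d (of_real x))) =
      mass a b d * pochhammer (b + d) k *
      (pochhammer (a + d) n / pochhammer (a + c) n * pochhammer (- of_nat n) k * ((- \<rho>) ^ n / fact n))"
proof -
  have int: "integrable lborel (weight (a + of_nat n) (b + of_nat j) d)" for j
    using assms by (intro integrable_weight) auto
  show "integrable lborel (\<lambda>x. hyp_term a b c \<rho> n x * (weight a b d x * cont_dual_Hahn k a b d (of_real x)))"
    unfolding hyp_term_times_weight[OF assms(1,2,4)]
    by (intro integrable_mult_right Bochner_Integration.integrable_sum int)
  have "(LBINT x. hyp_term a b c \<rho> n x * (weight a b d x * cont_dual_Hahn k a b d (of_real x))) =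
    (- \<rho>) ^ n / (fact n * pochhammer (a + b) n * pochhammer (a + c) n) *
      (\<Sum>j\<le>k. Hahn_coeff k a b d j * mass (a + of_nat n) (b + of_nat j) d)"
    unfolding hyp_term_times_weight[OF assms(1,2,4)] mass_def
    by (subst integral_mult_right_zero, subst Bochner_Integration.integral_sum)
      (auto intro!: integrable_mult_right int)
  moreover have "Re (a + b) > 0" using assms by simp
  ultimately show "(LBINT x. hyp_term a b c \<rho> n x * (weight a b d x * cont_dual_Hahn k a b d (of_real x))) =
      mass a b d * pochhammer (b + d) k *
      (pochhammer (a + d) n / pochhammer (a + c) n * pochhammer (- of_nat n) k * ((- \<rho>) ^ n / fact n))"
    unfolding moment_cont_dual_Hahn[OF assms(1,2,4)] using pochhammer_neq_0_Re_pos[of "a + b" n]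
    by (simp add: divide_simps mult_ac)
qed

text \<open>The first k terms vanish. After a shift of the index by k, (-(n + k))_k = (-1)^k (n +
  k)! / n! replaces (n + k)! by n! and cancels the sign of (-\<rho>)^k, which leaves a confluent
  series times \<rho>^k.\<close>

lemma moment_series_sums:
  assumes "Re (a + c) > 0"
  shows "(\<lambda>n. pochhammer (a + d) n / pochhammer (a + c) n * pochhammer (- of_nat n) k * ((- \<rho>) ^ n / fact n))
    sums (\<rho> ^ k * pochhammer (a + d) k / pochhammer (a + c) k * pFq [of_nat k + a + d] [of_nat k + a + c] (- \<rho>))"
    (is "?f sums ?s")
proof -
  define u where "u n = pochhammer (of_nat k + a + d) n / pochhammer (of_nat k + a + c) n * ((- \<rho>) ^ n / fact n)" for n
  have "summable u"
    unfolding u_def by (rule summable_norm_cancel[OF summable_1F1]) (use assms in simp)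
  moreover have "suminf u = pFq [of_nat k + a + d] [of_nat k + a + c] (- \<rho>)"
    by (simp add: pFq_altdef u_def[abs_def])
  ultimately have u: "u sums pFq [of_nat k + a + d] [of_nat k + a + c] (- \<rho>)"
    using summable_sums by metis
  have "?f (n + k) = \<rho> ^ k * pochhammer (a + d) k / pochhammer (a + c) k * u n" for n
  proof -
    have shift: "pochhammer (a + d) (n + k) = pochhammer (a + d) k * pochhammer (of_nat k + a + d) n"
      "pochhammer (a + c) (n + k) = pochhammer (a + c) k * pochhammer (of_nat k + a + c) n"
      using pochhammer_product'[of "a + d" k n] pochhammer_product'[of "a + c" k n]
      by (simp_all add: add_ac)
    have fact: "pochhammer (- of_nat (n + k)) k = (- 1) ^ k * (fact (n + k) / fact n :: complex)"
      unfolding pochhammer_minus_of_nat using binomial_fact[of k "n + k", where 'a = complex] by simp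
    have power: "(- \<rho>) ^ (n + k) = (- \<rho>) ^ n * ((- 1) ^ k * \<rho> ^ k)"
      by (simp only: power_add power_minus[of \<rho> k])
    have sign: "(- 1) ^ k * (- 1) ^ k = (1 :: complex)" by (simp flip: power_mult_distrib)
    \<comment> \<open>Here e stands for (-1)^k, F for (n + k)! and g for n!, while R and S are the
      powers (-\<rho>)^n and \<rho>^k.\<close>
    have "A1 * A2 / (B1 * B2) * (e * (F / g)) * (R * (e * S) / F) = S * A1 / B1 * (A2 / B2 * (R / g))"
      if "e * e = 1" "F \<noteq> 0" for A1 A2 B1 B2 e F g R S :: complex
    proof -
      have "A1 * A2 / (B1 * B2) * (e * (F / g)) * (R * (e * S) / F) =
        (e * e) * (F / F) * (S * A1 / B1 * (A2 / B2 * (R / g)))"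
        by (simp only: divide_inverse inverse_mult_distrib mult_ac)
      then show ?thesis using that by simp
    qed
    then show ?thesis
      unfolding u_def shift fact power using sign fact_nonzero by blast
  qed
  then have "(\<lambda>n. ?f (n + k)) sums ?s"
    using sums_mult[OF u, of "\<rho> ^ k * pochhammer (a + d) k / pochhammer (a + c) k"] by simp
  moreover have "(\<Sum>n<k. ?f n) = 0"
    by (intro sum.neutral) (auto simp: pochhammer_minus_of_nat binomial_eq_0)
  ultimately show ?thesis using sums_iff_shift[of ?f k ?s] by simp
qed

theorem corollary6p4:
  fixes k :: nat and \<rho> a b c d :: complex
  defines "f \<equiv> (\<lambda>x::real.
      exp \<rho> * pFq [a + \<i> * of_real x, a - \<i> * of_real x] [a + b, a + c] (- \<rho>) *
      of_real ((cmod (Gamma (a + \<i> * of_real x) * Gamma (b + \<i> * of_real x) *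
                      Gamma (d + \<i> * of_real x) / Gamma (2 * \<i> * of_real x)))\<^sup>2) *
      cont_dual_Hahn k a b d (of_real x))"
  assumes "Re a > 0" and "Re b > 0" and "Re c > 0" and "Re d > 0"
    and "real_or_conj_pair [a, b, c]" and "real_or_conj_pair [a, b, d]"
  shows "set_integrable lborel {0<..} f \<and>
    (LINT x:{0<..}|lborel. f x) =
      2 * of_real pi *
      (Gamma (a + b) * Gamma (of_nat k + a + d) * Gamma (of_nat k + b + d) /
         pochhammer (a + c) k) *
      pFq [c - d] [of_nat k + a + c] \<rho> * \<rho> ^ k"
proof -
  note pos = assms(2-5)
  have conj: "conj_closed a b d" using assms(7) by (rule conj_closed_if_real_or_conj_pair)
  have ab: "Re (a + b) > 0" and ac: "Re (a + c) > 0" and ad: "Re (a + d) > 0" and bd: "Re (b + d) > 0"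
    using pos by auto
  define T where "T = hyp_term a b c \<rho>"
  define D where "D x = weight a b d x * cont_dual_Hahn k a b d (of_real x)" for x :: real
  define G where "G x = (\<Sum>n. T n x * D x)" for x
  obtain C where "C \<ge> 0"
    "\<And>x. norm (weight a b d x * cont_dual_Hahn k a b d (of_real x)) \<le> C * exp (- (1 / 2) * \<bar>x\<bar>)"
    using weight_times_cont_dual_Hahn_decay[OF pos(1,2,4), of k] by blast
  note C = this(1) this(2)[folded D_def]
  \<comment> \<open>A rate below 1/2, the decay rate of weight times polynomial; the products then
    still decay with rate 1/4.\<close>
  have "(0 :: real) < 1 / 4" by simp
  from hyp_term_bound[OF ab ac this] obtain M where "summable M" "\<And>n. M n \<ge> 0"
    "\<And>n x. norm (hyp_term a b c \<rho> n x) \<le> M n * exp (1 / 4 * \<bar>x\<bar>)"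
    by blast
  note M = this(1,2) this(3)[folded T_def]
  have summable_T: "summable (\<lambda>n. norm (T n x))" for x
    by (rule summable_comparison_test'[OF summable_mult2[OF M(1), of "exp (1 / 4 * \<bar>x\<bar>)"], of 0])
      (use M(3)[of _ x] in simp)
  have bound: "norm (T n x * D x) \<le> M n * (C * exp (- (1 / 4) * \<bar>x\<bar>))" for n x
  proof -
    have "norm (T n x * D x) \<le> (M n * exp (1 / 4 * \<bar>x\<bar>)) * (C * exp (- (1 / 2) * \<bar>x\<bar>))"
      unfolding norm_mult using M(2) by (intro mult_mono M(3) C(2)) auto
    also have "\<dots> = M n * (C * exp (1 / 4 * \<bar>x\<bar> + - (1 / 2) * \<bar>x\<bar>))"
      by (simp only: exp_add mult_ac)
    also have "1 / 4 * \<bar>x\<bar> + - (1 / 2) * \<bar>x\<bar> = - (1 / 4) * \<bar>x\<bar>" by simp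
    finally show ?thesis .
  qed
  have int: "integrable lborel (\<lambda>x. T n x * D x)" for n
    unfolding T_def D_def by (rule integral_hyp_term(1)[OF pos])
  have int_exp: "integrable lborel (\<lambda>x::real. C * exp (- (1 / 4) * \<bar>x\<bar>))"
    using integrable_exp_minus_abs[of "1 / 4"] by (intro integrable_mult_right) simp
  have AE: "AE x in lborel. summable (\<lambda>n. norm (T n x * D x))"
    unfolding norm_mult by (intro AE_I2 summable_mult2 summable_T)
  have "norm (LBINT x. norm (T n x * D x)) \<le> M n * (LBINT x. C * exp (- (1 / 4) * \<bar>x\<bar>))" for n
  proof -
    have "(LBINT x. norm (T n x * D x)) \<le> (LBINT x. M n * (C * exp (- (1 / 4) * \<bar>x\<bar>)))"
      by (rule integral_mono[OF integrable_norm[OF int] integrable_mult_right[OF int_exp] bound])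
    then show ?thesis by simp
  qed
  \<comment> \<open>Summability of the L1 norms justifies the exchange of series and integral, and
    with it the integrability of the limit.\<close>
  then have summable_int: "summable (\<lambda>n. LBINT x. norm (T n x * D x))"
    by (rule summable_comparison_test'[OF summable_mult2[OF M(1)]])
  have int_G: "integrable lborel G"
    unfolding G_def[abs_def] by (rule integrable_suminf[OF int AE summable_int])
  have "(\<lambda>n. LBINT x. T n x * D x) sums (LBINT x. G x)"
    unfolding G_def by (rule sums_integral[OF int AE summable_int])
  then have "(LBINT x. G x) = (\<Sum>n. LBINT x. T n x * D x)"
    by (rule sums_unique)
  also have "\<dots> = mass a b d * pochhammer (b + d) k *
     (\<rho> ^ k * pochhammer (a + d) k / pochhammer (a + c) k * pFq [of_nat k + a + d] [of_nat k + a + c] (- \<rho>))"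
    unfolding T_def D_def integral_hyp_term(2)[OF pos]
    by (intro sums_unique[symmetric] sums_mult moment_series_sums ac)
  finally have G: "(LBINT x. G x) = mass a b d * pochhammer (b + d) k *
     (\<rho> ^ k * pochhammer (a + d) k / pochhammer (a + c) k * pFq [of_nat k + a + d] [of_nat k + a + c] (- \<rho>))" .
  \<comment> \<open>In this expansion the evenness of the integrand is inherited from the
    weights.\<close>
  have "D x = (\<Sum>j\<le>k. Hahn_coeff k a b d j * weight a (b + of_nat j) d x)" for x
    unfolding D_def by (rule weight_times_cont_dual_Hahn[OF pos(1,2,4)])
  then have "D (- x) = D x" for x
    by (simp only: weight_minus)
  moreover have "T n (- x) = T n x" for n x
    by (simp add: T_def hyp_term_def mult.commute)
  ultimately have G_even: "G (- x) = G x" for x by (simp add: G_def)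
  have f_eq: "f x = exp \<rho> * G x" if "x \<in> {0<..}" for x
  proof -
    have "of_real ((cmod (Gamma (a + \<i> * of_real x) * Gamma (b + \<i> * of_real x) *
        Gamma (d + \<i> * of_real x) / Gamma (2 * \<i> * of_real x)))\<^sup>2) = weight a b d x"
      using that by (intro norm_Gamma_quotient_eq_weight conj) auto
    moreover have "pFq [a + \<i> * of_real x, a - \<i> * of_real x] [a + b, a + c] (- \<rho>) = (\<Sum>n. T n x)"
      by (simp add: pFq_altdef T_def hyp_term_def)
    moreover have "G x = (\<Sum>n. T n x) * D x"
      unfolding G_def by (rule suminf_mult2[symmetric]) (rule summable_norm_cancel[OF summable_T])
    ultimately show ?thesis unfolding f_def D_def by (simp only: mult.assoc)
  qed
  have set_integrable_f: "set_integrable lborel {0<..} f = set_integrable lborel {0<..} (\<lambda>x. exp \<rho> * G x)"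
    by (rule set_integrable_cong[OF refl refl f_eq])
  have set_integrable_G: "set_integrable lborel {0<..} (\<lambda>x. exp \<rho> * G x)"
    unfolding set_integrable_def
    by (rule integrable_mult_indicator[OF _ integrable_mult_right[OF int_G]]) simp
  have integral_f: "(LINT x:{0<..}|lborel. f x) = exp \<rho> * (LBINT x. G x) / 2"
  proof -
    have "(LINT x:{0<..}|lborel. f x) = (LINT x:{0<..}|lborel. exp \<rho> * G x)"
      using f_eq by (intro set_lebesgue_integral_cong) auto
    also have "\<dots> = exp \<rho> * (LINT x:{0<..}|lborel. G x)"
      by (rule set_integral_mult_right)
    finally show ?thesis by (simp add: integral_even_halfline[OF int_G G_even])
  qed
  have value_G: "exp \<rho> * (LBINT x. G x) / 2 = 2 * of_real pi *
      (Gamma (a + b) * Gamma (of_nat k + a + d) * Gamma (of_nat k + b + d) / pochhammer (a + c) k) *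
      pFq [c - d] [of_nat k + a + c] \<rho> * \<rho> ^ k"
  proof -
    \<comment> \<open>The parameters k + a + c and k + a + d differ by c - d, and the prefactor
      e^\<rho> of the integrand is the one in Kummer's transformation.\<close>
    have Kummer: "pFq [c - d] [of_nat k + a + c] \<rho> =
      exp \<rho> * pFq [of_nat k + a + d] [of_nat k + a + c] (- \<rho>)"
      using Kummer_transformation[of "of_nat k + a + c" \<rho> "of_nat k + a + d"] ac by simp
    have shift: "Gamma (of_nat k + p) = pochhammer p k * Gamma p" if "Re p > 0" for p :: complex
      using pochhammer_Gamma[of p k] nonpos_Ints_Re_pos[OF that] Gamma_neq_0_Re_pos[OF that]
      by (simp add: add.commute)
    \<comment> \<open>The constant 4 pi belongs to the whole line; the half line leaves 2 pi. The
      symbols p and q are the Pochhammer factors that raise the two Gamma values by k.\<close>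
    have "e * (4 * u * (g1 * g2 * g3) * q * (r * p / s * F)) / 2 =
      2 * u * (g1 * (p * g2) * (q * g3) / s) * (e * F) * r" for e u g1 g2 g3 p q r s F :: complex
      by simp
    then show ?thesis
      unfolding Kummer G mass_formula[OF pos(1,2,4) conj]
        shift[OF ad, folded add.assoc] shift[OF bd, folded add.assoc] .
  qed
  show ?thesis
    unfolding set_integrable_f integral_f value_G using set_integrable_G by simp
qed

end
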